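(* Let $R$ be a semiring with $1\notin Z(R)$, and let $I$ be a left ideal of $R$. Then the following statements are equivalent: (i) $I\subseteq J(R)$; (ii) for any $w$-finitely generated left $R$-semimodule $M$, if $IM=M$, then $M=Z(M)$.
   Context: A hemiring $(R,+,\cdot,0)$ consists of a commutative monoid $(R,+,0)$ and a semigroup $(R,\cdot)$ such that multiplication distributes over addition on both sides and $0r=0=r0$ for all $r$. A semiring is a hemiring with a multiplicative identity $1$. A left $R$-semimodule over a semiring $R$ is a commutative monoid $(M,+,0_M)$ with a scalar multiplication $R\times M\to M$ satisfying $(rr')m=r(r'm)$, $r(m+m')=rm+rm'$, $(r+r')m=rm+r'm$, $r0_M=0_M=0m$, $1m=m$. $IM$ is the set of finite sums of elements $am$ with $a\in I$, $m\in M$. Zeroids: $Z(R)=\{r\in R\mid r+x=x\text{ for some }x\in R\}$ and $Z(M)=\{m\in M\mid m+x=x\text{ for some }x\in M\}$. A left $R$-semimodule $M$ is $w$-finitely generated if there exist a natural number $n$ and pairs $(m_1,m_1'),\dots,(m_n,m_n')\in M^2$ such that for every $m\in M$ there exist pairs $(r_1,s_1),\dots,(r_n,s_n)\in R^2$ with $$m+(r_1m_1'+s_1m_1)+\dots+(r_nm_n'+s_nm_n)=(r_1m_1+s_1m_1')+\dots+(r_nm_n+s_nm_n').$$ Jacobson(-Bourne) radical: a right ideal $K$ of $R$ is right semiregular if for all $i_1,i_2\in K$ there are $j_1,j_2\in K$ with $i_1+j_1+i_1j_1+i_2j_2=i_2+j_2+i_1j_2+i_2j_1$; $J(R)$ is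 the sum of all right semiregular right ideals of $R$. It is a two-sided ideal. Equivalently (known), $J(R)=\bigcap\{r\in R\mid rM=0\}$ over all irreducible left $R$-semimodules $M$ (with $J(R)=R$ if there are none), where a nonzero additively cancellative left semimodule $M$ is irreducible if for all $m_1\neq m_2$ and $m$ in $M$ there are $r_1,r_2\in R$ with $m+r_1m_1+r_2m_2=r_1m_2+r_2m_1$. *)

theory Defs
  imports "HOL-Algebra.Module"
begin

(* Semirings are the HOL-Algebra locale "semiring" (not assumed commutative).  The library's
   locale "module" requires a commutative ring of scalars, so only its record type is reused;
   the multiplicative part (mult, one) of that record plays no role for a semimodule. *)
locale semimodule = R?: semiring R + M?: abelian_monoid M
  for R :: "('r, 'x) ring_scheme" (structure) and M :: "('r, 'm, 'y) module_scheme" (structure) +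
  assumes smult_closed:
      "\<lbrakk>r \<in> carrier R; m \<in> carrier M\<rbrakk> \<Longrightarrow> r \<odot>\<^bsub>M\<^esub> m \<in> carrier M"
    and smult_assoc:
      "\<lbrakk>r \<in> carrier R; r' \<in> carrier R; m \<in> carrier M\<rbrakk>
        \<Longrightarrow> (r \<otimes>\<^bsub>R\<^esub> r') \<odot>\<^bsub>M\<^esub> m = r \<odot>\<^bsub>M\<^esub> (r' \<odot>\<^bsub>M\<^esub> m)"
    and smult_r_distr:
      "\<lbrakk>r \<in> carrier R; m \<in> carrier M; m' \<in> carrier M\<rbrakk>
        \<Longrightarrow> r \<odot>\<^bsub>M\<^esub> (m \<oplus>\<^bsub>M\<^esub> m') = r \<odot>\<^bsub>M\<^esub> m \<oplus>\<^bsub>M\<^esub> r \<odot>\<^bsub>M\<^esub> m'"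
    and smult_l_distr:
      "\<lbrakk>r \<in> carrier R; r' \<in> carrier R; m \<in> carrier M\<rbrakk>
        \<Longrightarrow> (r \<oplus>\<^bsub>R\<^esub> r') \<odot>\<^bsub>M\<^esub> m = r \<odot>\<^bsub>M\<^esub> m \<oplus>\<^bsub>M\<^esub> r' \<odot>\<^bsub>M\<^esub> m"
    and smult_r_null: "r \<in> carrier R \<Longrightarrow> r \<odot>\<^bsub>M\<^esub> \<zero>\<^bsub>M\<^esub> = \<zero>\<^bsub>M\<^esub>"
    and smult_l_null: "m \<in> carrier M \<Longrightarrow> \<zero>\<^bsub>R\<^esub> \<odot>\<^bsub>M\<^esub> m = \<zero>\<^bsub>M\<^esub>"
    and smult_one: "m \<in> carrier M \<Longrightarrow> \<one>\<^bsub>R\<^esub> \<odot>\<^bsub>M\<^esub> m = m"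

(* Used both for the semiring and, since a module record extends a ring record, for semimodules. *)
definition zeroid :: "('a, 'x) ring_scheme \<Rightarrow> 'a set" where
  "zeroid G = {a \<in> carrier G. \<exists>x \<in> carrier G. a \<oplus>\<^bsub>G\<^esub> x = x}"

definition finite_sums :: "('a, 'x) ring_scheme \<Rightarrow> 'a set \<Rightarrow> 'a set" where
  "finite_sums G S = {\<Oplus>\<^bsub>G\<^esub>i\<in>{..<n}. f i | (n::nat) f. f \<in> {..<n} \<rightarrow> S}"

definition left_ideal :: "('r, 'x) ring_scheme \<Rightarrow> 'r set \<Rightarrow> bool" where
  "left_ideal R I \<longleftrightarrow> I \<subseteq> carrier R \<and> \<zero>\<^bsub>R\<^esub> \<in> I \<and>
     (\<forall>a\<in>I. \<forall>b\<in>I. a \<oplus>\<^bsub>R\<^esub> b \<in> I) \<and> (\<forall>r\<in>carrier R. \<forall>a\<in>I. r \<otimes>\<^bsub>R\<^esub> a \<in> I)"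

definition right_ideal :: "('r, 'x) ring_scheme \<Rightarrow> 'r set \<Rightarrow> bool" where
  "right_ideal R K \<longleftrightarrow> K \<subseteq> carrier R \<and> \<zero>\<^bsub>R\<^esub> \<in> K \<and>
     (\<forall>a\<in>K. \<forall>b\<in>K. a \<oplus>\<^bsub>R\<^esub> b \<in> K) \<and> (\<forall>r\<in>carrier R. \<forall>a\<in>K. a \<otimes>\<^bsub>R\<^esub> r \<in> K)"

definition right_semiregular :: "('r, 'x) ring_scheme \<Rightarrow> 'r set \<Rightarrow> bool" where
  "right_semiregular R K \<longleftrightarrow>
     (\<forall>i1\<in>K. \<forall>i2\<in>K. \<exists>j1\<in>K. \<exists>j2\<in>K.
        i1 \<oplus>\<^bsub>R\<^esub> j1 \<oplus>\<^bsub>R\<^esub> i1 \<otimes>\<^bsub>R\<^esub> j1 \<oplus>\<^bsub>R\<^esub> i2 \<otimes>\<^bsub>R\<^esub> j2 =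
        i2 \<oplus>\<^bsub>R\<^esub> j2 \<oplus>\<^bsub>R\<^esub> i1 \<otimes>\<^bsub>R\<^esub> j2 \<oplus>\<^bsub>R\<^esub> i2 \<otimes>\<^bsub>R\<^esub> j1)"

definition jacobson_radical :: "('r, 'x) ring_scheme \<Rightarrow> 'r set" where
  "jacobson_radical R = finite_sums R (\<Union>{K. right_ideal R K \<and> right_semiregular R K})"

definition ideal_smult ::
    "'r set \<Rightarrow> ('r, 'm, 'y) module_scheme \<Rightarrow> 'm set" where
  "ideal_smult I M = finite_sums M {a \<odot>\<^bsub>M\<^esub> m | a m. a \<in> I \<and> m \<in> carrier M}"

definition w_finitely_generated ::
    "('r, 'x) ring_scheme \<Rightarrow> ('r, 'm, 'y) module_scheme \<Rightarrow> bool" where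
  "w_finitely_generated R M \<longleftrightarrow>
     (\<exists>(n::nat) g g'. g \<in> {..<n} \<rightarrow> carrier M \<and> g' \<in> {..<n} \<rightarrow> carrier M \<and>
        (\<forall>m\<in>carrier M. \<exists>r s. r \<in> {..<n} \<rightarrow> carrier R \<and> s \<in> {..<n} \<rightarrow> carrier R \<and>
           m \<oplus>\<^bsub>M\<^esub> (\<Oplus>\<^bsub>M\<^esub>i\<in>{..<n}. r i \<odot>\<^bsub>M\<^esub> g' i \<oplus>\<^bsub>M\<^esub> s i \<odot>\<^bsub>M\<^esub> g i) =
           (\<Oplus>\<^bsub>M\<^esub>i\<in>{..<n}. r i \<odot>\<^bsub>M\<^esub> g i \<oplus>\<^bsub>M\<^esub> s i \<odot>\<^bsub>M\<^esub> g' i)))"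

end

theory Submission
  imports Defs
begin

text \<open>
  The idea is to replace the semiring \<open>R\<close> by its ring of differences \<open>D\<close>, the ring of formal
  differences \<open>a - b\<close>, and a semimodule \<open>M\<close> by its difference module, which is a module over \<open>D\<close>.
  An element of \<open>M\<close> vanishes in the difference module exactly when it lies in the zeroid of \<open>M\<close>, so
  \<open>M = Z(M)\<close> means that the difference module is zero. On the side of the semiring, the radical
  \<open>J(R)\<close> is the preimage of the Jacobson radical of \<open>D\<close> (\<open>jacobson_radical_eq_preimage\<close>). The
  delicate point there is that right semiregularity is an equation in \<open>R\<close>, whereas \<open>D\<close> sees equations
  only up to a common summand.

  For (i) to (ii), a w-finitely generated semimodule has a finitely generated difference module, and
  \<open>I M = M\<close> makes the generators combinations of each other with coefficients in the radical of \<open>D\<close>.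
  The lemma \<open>nakayama\<close> then shows that the difference module is zero (\<open>jacobson_radical_imp_zeroid\<close>).

  For (ii) to (i), let \<open>a\<close> be an element of \<open>I\<close> outside \<open>J(R)\<close>. The radical of \<open>D\<close> being left-right
  symmetric, there is \<open>x\<close> in \<open>D\<close> such that \<open>t = 1 + x a\<close> has no left inverse. The module \<open>D / D t\<close> is
  cyclic and nonzero, and since \<open>1 = - x a\<close> in it, it equals its product with \<open>I\<close>. Its zeroid is zero,
  because it is a group, so it violates (ii) (\<open>cyclic_module_of_nonradical\<close>).
\<close>

declare (in semimodule) smult_closed [simp, intro] smult_r_null [simp] smult_l_null [simp]
  smult_one [simp]

section \<open>Quotients of semimodules\<close>

definition quot_semimodule ::
    "('r, 'm, 'y) module_scheme \<Rightarrow> ('m \<times> 'm) set \<Rightarrow> ('r, 'm set) module" where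
  "quot_semimodule M E =
     \<lparr>carrier = carrier M // E, mult = undefined, one = undefined, zero = E `` {\<zero>\<^bsub>M\<^esub>},
      add = (\<lambda>X Y. \<Union>x\<in>X. \<Union>y\<in>Y. E `` {x \<oplus>\<^bsub>M\<^esub> y}), smult = (\<lambda>r X. \<Union>x\<in>X. E `` {r \<odot>\<^bsub>M\<^esub> x})\<rparr>"

locale semimodule_congruence = semimodule R M for R (structure) and M (structure) +
  fixes E :: "('b \<times> 'b) set"
  assumes equiv: "equiv (carrier M) E"
    and add_cong: "(x, x') \<in> E \<Longrightarrow> (y, y') \<in> E \<Longrightarrow> (x \<oplus>\<^bsub>M\<^esub> y, x' \<oplus>\<^bsub>M\<^esub> y') \<in> E"
    and smult_cong: "r \<in> carrier R \<Longrightarrow> (x, y) \<in> E \<Longrightarrow> (r \<odot>\<^bsub>M\<^esub> x, r \<odot>\<^bsub>M\<^esub> y) \<in> E"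
begin

abbreviation Q where "Q \<equiv> quot_semimodule M E"

lemma quot_add:
  assumes "x \<in> carrier M" "y \<in> carrier M"
  shows "E `` {x} \<oplus>\<^bsub>Q\<^esub> E `` {y} = E `` {x \<oplus>\<^bsub>M\<^esub> y}"
proof -
  have "congruent2 E E (\<lambda>x y. E `` {x \<oplus>\<^bsub>M\<^esub> y})"
    by (intro congruent2I' equiv_class_eq[OF equiv] add_cong)
  from UN_equiv_class2[OF equiv equiv this assms] show ?thesis
    by (simp add: quot_semimodule_def)
qed

lemma quot_smult:
  assumes "r \<in> carrier R" "x \<in> carrier M"
  shows "r \<odot>\<^bsub>Q\<^esub> (E `` {x}) = E `` {r \<odot>\<^bsub>M\<^esub> x}"
proof -
  have "congruent E (\<lambda>x. E `` {r \<odot>\<^bsub>M\<^esub> x})"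
    by (intro congruentI equiv_class_eq[OF equiv] smult_cong assms(1))
  from UN_equiv_class[OF equiv this assms(2)] show ?thesis
    by (simp add: quot_semimodule_def)
qed

lemma quot_zero: "\<zero>\<^bsub>Q\<^esub> = E `` {\<zero>\<^bsub>M\<^esub>}"
  by (simp add: quot_semimodule_def)

lemma quot_carrierI: "x \<in> carrier M \<Longrightarrow> E `` {x} \<in> carrier Q"
  by (simp add: quot_semimodule_def quotientI)

lemma quot_carrierE:
  assumes "X \<in> carrier Q"
  obtains x where "x \<in> carrier M" "X = E `` {x}"
  using assms by (auto simp: quot_semimodule_def elim: quotientE)

lemma quot_eq_iff:
  "x \<in> carrier M \<Longrightarrow> y \<in> carrier M \<Longrightarrow> E `` {x} = E `` {y} \<longleftrightarrow> (x, y) \<in> E"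
  by (rule eq_equiv_class_iff[OF equiv])

lemma semimodule_quot: "semimodule R Q"
proof -
  have "abelian_monoid Q"
    by (rule abelian_monoidI)
      (auto elim!: quot_carrierE simp: quot_add quot_zero quot_carrierI M.a_ac)
  moreover have "semimodule_axioms R Q"
    by unfold_locales
      (auto elim!: quot_carrierE simp: quot_add quot_zero quot_smult quot_carrierI
        smult_assoc smult_r_distr smult_l_distr)
  ultimately show ?thesis
    by (intro semimodule.intro R.semiring_axioms)
qed

end

section \<open>Modules of differences\<close>

definition pair_semimodule ::
    "('r, 'm, 'y) module_scheme \<Rightarrow> ('r, 'm \<times> 'm) module" where
  "pair_semimodule M =
     \<lparr>carrier = carrier M \<times> carrier M, mult = undefined, one = undefined, zero = (\<zero>\<^bsub>M\<^esub>, \<zero>\<^bsub>M\<^esub>),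
      add = (\<lambda>p q. (fst p \<oplus>\<^bsub>M\<^esub> fst q, snd p \<oplus>\<^bsub>M\<^esub> snd q)),
      smult = (\<lambda>r p. (r \<odot>\<^bsub>M\<^esub> fst p, r \<odot>\<^bsub>M\<^esub> snd p))\<rparr>"

text \<open>
  Two pairs have the same difference as soon as \<open>a + d\<close> and \<open>c + b\<close> agree after adding a common
  element: this is the relation that the universal map to a group imposes, so the classes form the
  group completion of \<open>M\<close>, and \<open>m\<close> becomes zero there exactly when \<open>m\<close> is in the zeroid.
\<close>

definition same_difference :: "('m, 'y) ring_scheme \<Rightarrow> (('m \<times> 'm) \<times> 'm \<times> 'm) set" where
  "same_difference M =
     {((a, b), (c, d)). a \<in> carrier M \<and> b \<in> carrier M \<and> c \<in> carrier M \<and> d \<in> carrier M \<and>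
        (\<exists>x\<in>carrier M. a \<oplus>\<^bsub>M\<^esub> d \<oplus>\<^bsub>M\<^esub> x = c \<oplus>\<^bsub>M\<^esub> b \<oplus>\<^bsub>M\<^esub> x)}"

definition difference_module ::
    "('r, 'm, 'y) module_scheme \<Rightarrow> ('r, ('m \<times> 'm) set) module" where
  "difference_module M = quot_semimodule (pair_semimodule M) (same_difference M)"

text \<open>
  The formal difference \<open>a - b\<close>. Only the addition of \<open>M\<close> enters, so the same constant serves for
  elements of a semimodule and of the semiring.
\<close>

definition diff :: "('m, 'y) ring_scheme \<Rightarrow> 'm \<Rightarrow> 'm \<Rightarrow> ('m \<times> 'm) set" where
  "diff M a b = same_difference M `` {(a, b)}"

lemma (in semimodule) semimodule_pair: "semimodule R (pair_semimodule M)"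
proof -
  have "abelian_monoid (pair_semimodule M)"
    by (rule abelian_monoidI) (auto simp: pair_semimodule_def M.a_ac)
  moreover have "semimodule_axioms R (pair_semimodule M)"
    by unfold_locales
      (auto simp: pair_semimodule_def smult_assoc smult_r_distr smult_l_distr)
  ultimately show ?thesis
    by (intro semimodule.intro R.semiring_axioms)
qed

lemma (in abelian_monoid) equiv_same_difference:
  "equiv (carrier G \<times> carrier G) (same_difference G)"
proof (rule equivI)
  show "same_difference G \<subseteq> (carrier G \<times> carrier G) \<times> carrier G \<times> carrier G"
    by (auto simp: same_difference_def)
  show "refl_on (carrier G \<times> carrier G) (same_difference G)"
    by (auto simp: same_difference_def refl_on_def)
  show "sym (same_difference G)"
    by (auto simp: same_difference_def sym_def) metis
  show "trans (same_difference G)"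
  proof (rule transI)
    fix p q r
    assume "(p, q) \<in> same_difference G" "(q, r) \<in> same_difference G"
    then obtain a b c d e f x y where p: "p = (a, b)" "q = (c, d)" "r = (e, f)"
      and [simp]: "a \<in> carrier G" "b \<in> carrier G" "c \<in> carrier G" "d \<in> carrier G"
        "e \<in> carrier G" "f \<in> carrier G" "x \<in> carrier G" "y \<in> carrier G"
      and x: "a \<oplus> d \<oplus> x = c \<oplus> b \<oplus> x" and y: "c \<oplus> f \<oplus> y = e \<oplus> d \<oplus> y"
      by (auto simp: same_difference_def)
    have "a \<oplus> f \<oplus> (d \<oplus> x \<oplus> y) = (a \<oplus> d \<oplus> x) \<oplus> (f \<oplus> y)"
      by (simp add: a_ac)
    also have "\<dots> = (c \<oplus> f \<oplus> y) \<oplus> (b \<oplus> x)"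
      unfolding x by (simp add: a_ac)
    also have "\<dots> = e \<oplus> b \<oplus> (d \<oplus> x \<oplus> y)"
      unfolding y by (simp add: a_ac)
    finally show "(p, r) \<in> same_difference G"
      by (auto simp: same_difference_def p intro!: bexI[of _ "d \<oplus> x \<oplus> y"])
  qed
qed

context semimodule
begin

lemma congruence_same_difference:
  "semimodule_congruence R (pair_semimodule M) (same_difference M)"
proof (intro semimodule_congruence.intro semimodule_pair semimodule_congruence_axioms.intro)
  show "equiv (carrier (pair_semimodule M)) (same_difference M)"
    using M.equiv_same_difference by (simp add: pair_semimodule_def)
next
  fix p p' q q'
  assume "(p, p') \<in> same_difference M" "(q, q') \<in> same_difference M"
  then obtain a b c d x a' b' c' d' x' where
    p: "p = (a, b)" "p' = (c, d)" "q = (a', b')" "q' = (c', d')"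
    and [simp]: "a \<in> carrier M" "b \<in> carrier M" "c \<in> carrier M" "d \<in> carrier M"
      "a' \<in> carrier M" "b' \<in> carrier M" "c' \<in> carrier M" "d' \<in> carrier M"
      "x \<in> carrier M" "x' \<in> carrier M"
    and x: "a \<oplus>\<^bsub>M\<^esub> d \<oplus>\<^bsub>M\<^esub> x = c \<oplus>\<^bsub>M\<^esub> b \<oplus>\<^bsub>M\<^esub> x" "a' \<oplus>\<^bsub>M\<^esub> d' \<oplus>\<^bsub>M\<^esub> x' = c' \<oplus>\<^bsub>M\<^esub> b' \<oplus>\<^bsub>M\<^esub> x'"
    by (auto simp: same_difference_def)
  have "(a \<oplus>\<^bsub>M\<^esub> a') \<oplus>\<^bsub>M\<^esub> (d \<oplus>\<^bsub>M\<^esub> d') \<oplus>\<^bsub>M\<^esub> (x \<oplus>\<^bsub>M\<^esub> x') =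
      (a \<oplus>\<^bsub>M\<^esub> d \<oplus>\<^bsub>M\<^esub> x) \<oplus>\<^bsub>M\<^esub> (a' \<oplus>\<^bsub>M\<^esub> d' \<oplus>\<^bsub>M\<^esub> x')"
    by (simp add: M.a_ac)
  also have "\<dots> = (c \<oplus>\<^bsub>M\<^esub> c') \<oplus>\<^bsub>M\<^esub> (b \<oplus>\<^bsub>M\<^esub> b') \<oplus>\<^bsub>M\<^esub> (x \<oplus>\<^bsub>M\<^esub> x')"
    unfolding x by (simp add: M.a_ac)
  finally show "(p \<oplus>\<^bsub>pair_semimodule M\<^esub> q, p' \<oplus>\<^bsub>pair_semimodule M\<^esub> q') \<in> same_difference M"
    by (auto simp: same_difference_def pair_semimodule_def p intro!: bexI[of _ "x \<oplus>\<^bsub>M\<^esub> x'"])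
next
  fix r p p'
  assume [simp]: "r \<in> carrier R" and "(p, p') \<in> same_difference M"
  then obtain a b c d x where p: "p = (a, b)" "p' = (c, d)"
    and [simp]: "a \<in> carrier M" "b \<in> carrier M" "c \<in> carrier M" "d \<in> carrier M" "x \<in> carrier M"
    and x: "a \<oplus>\<^bsub>M\<^esub> d \<oplus>\<^bsub>M\<^esub> x = c \<oplus>\<^bsub>M\<^esub> b \<oplus>\<^bsub>M\<^esub> x"
    by (auto simp: same_difference_def)
  from arg_cong[OF x, of "\<lambda>z. r \<odot>\<^bsub>M\<^esub> z"]
  have "r \<odot>\<^bsub>M\<^esub> a \<oplus>\<^bsub>M\<^esub> r \<odot>\<^bsub>M\<^esub> d \<oplus>\<^bsub>M\<^esub> r \<odot>\<^bsub>M\<^esub> x = r \<odot>\<^bsub>M\<^esub> c \<oplus>\<^bsub>M\<^esub> r \<odot>\<^bsub>M\<^esub> b \<oplus>\<^bsub>M\<^esub> r \<odot>\<^bsub>M\<^esub> x"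
    by (simp add: smult_r_distr)
  then show "(r \<odot>\<^bsub>pair_semimodule M\<^esub> p, r \<odot>\<^bsub>pair_semimodule M\<^esub> p') \<in> same_difference M"
    by (auto simp: same_difference_def pair_semimodule_def p intro!: bexI[of _ "r \<odot>\<^bsub>M\<^esub> x"])
qed

interpretation same_difference: semimodule_congruence R "pair_semimodule M" "same_difference M"
  by (rule congruence_same_difference)

lemma semimodule_difference_module: "semimodule R (difference_module M)"
  using same_difference.semimodule_quot by (simp add: difference_module_def)

lemma diff_closed [simp, intro]:
  "a \<in> carrier M \<Longrightarrow> b \<in> carrier M \<Longrightarrow> diff M a b \<in> carrier (difference_module M)"
  using same_difference.quot_carrierI[of "(a, b)"]
  by (simp add: pair_semimodule_def difference_module_def diff_def)

lemma diff_cases: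
  assumes "v \<in> carrier (difference_module M)"
  obtains a b where "a \<in> carrier M" "b \<in> carrier M" "v = diff M a b"
proof -
  from assms obtain p where "p \<in> carrier (pair_semimodule M)" "v = same_difference M `` {p}"
    by (auto simp: difference_module_def elim: same_difference.quot_carrierE)
  then show ?thesis
    by (intro that[of "fst p" "snd p"]) (auto simp: pair_semimodule_def diff_def)
qed

lemma diff_eq_iff:
  assumes "a \<in> carrier M" "b \<in> carrier M" "c \<in> carrier M" "d \<in> carrier M"
  shows "diff M a b = diff M c d \<longleftrightarrow> (\<exists>x\<in>carrier M. a \<oplus>\<^bsub>M\<^esub> d \<oplus>\<^bsub>M\<^esub> x = c \<oplus>\<^bsub>M\<^esub> b \<oplus>\<^bsub>M\<^esub> x)"
  using same_difference.quot_eq_iff[of "(a, b)" "(c, d)"] assms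
  by (simp add: diff_def pair_semimodule_def same_difference_def)

lemma diff_add:
  assumes "a \<in> carrier M" "b \<in> carrier M" "c \<in> carrier M" "d \<in> carrier M"
  shows "diff M a b \<oplus>\<^bsub>difference_module M\<^esub> diff M c d = diff M (a \<oplus>\<^bsub>M\<^esub> c) (b \<oplus>\<^bsub>M\<^esub> d)"
  using same_difference.quot_add[of "(a, b)" "(c, d)"] assms
  by (simp add: diff_def pair_semimodule_def difference_module_def)

lemma diff_smult:
  assumes "r \<in> carrier R" "a \<in> carrier M" "b \<in> carrier M"
  shows "r \<odot>\<^bsub>difference_module M\<^esub> diff M a b = diff M (r \<odot>\<^bsub>M\<^esub> a) (r \<odot>\<^bsub>M\<^esub> b)"
  using same_difference.quot_smult[of r "(a, b)"] assms
  by (simp add: diff_def pair_semimodule_def difference_module_def)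

lemma diff_zero: "\<zero>\<^bsub>difference_module M\<^esub> = diff M \<zero>\<^bsub>M\<^esub> \<zero>\<^bsub>M\<^esub>"
  using same_difference.quot_zero
  by (simp add: diff_def pair_semimodule_def difference_module_def)

lemma diff_self: 
  assumes "a \<in> carrier M" shows "diff M a a = \<zero>\<^bsub>difference_module M\<^esub>"
  unfolding diff_zero using assms by (subst diff_eq_iff) (auto simp: M.a_ac)

lemma abelian_group_difference_module: "abelian_group (difference_module M)"
proof -
  interpret V: semimodule R "difference_module M"
    by (rule semimodule_difference_module)
  have "\<exists>w\<in>carrier (difference_module M). w \<oplus>\<^bsub>difference_module M\<^esub> v = \<zero>\<^bsub>difference_module M\<^esub>"
    if "v \<in> carrier (difference_module M)" for v
  proof -
    from that obtain a b where "a \<in> carrier M" "b \<in> carrier M" "v = diff M a b"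
      by (rule diff_cases)
    then show ?thesis
      by (auto intro!: bexI[of _ "diff M b a"] simp: diff_add M.a_comm[of b a] diff_self)
  qed
  then show ?thesis
    by (intro abelian_groupI) (auto simp: V.M.a_ac)
qed

lemma diff_minus:
  assumes "a \<in> carrier M" "b \<in> carrier M"
  shows "\<ominus>\<^bsub>difference_module M\<^esub> diff M a b = diff M b a"
proof -
  interpret V: abelian_group "difference_module M"
    by (rule abelian_group_difference_module)
  show ?thesis
    using assms by (intro V.minus_equality) (simp_all add: diff_add M.a_comm[of b a] diff_self)
qed

end

section \<open>The ring of differences\<close>

definition regular_module :: "('r, 'x) ring_scheme \<Rightarrow> ('r, 'r) module" where
  "regular_module R =
     \<lparr>carrier = carrier R, mult = mult R, one = \<one>\<^bsub>R\<^esub>, zero = \<zero>\<^bsub>R\<^esub>, add = add R, smult = mult R\<rparr>"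

text \<open>
  A semiring acting on an abelian group \<open>V\<close> also has its formal differences acting, by
  \<open>(r - s) v = r v - s v\<close>. Choosing a representing pair costs nothing: in a group the right-hand side
  depends only on the difference. Taking for \<open>V\<close> the group completion of the semiring itself
  gives the multiplication of the ring of differences.
\<close>

definition difference_action ::
    "('r, 'x) ring_scheme \<Rightarrow> ('r, 'm, 'y) module_scheme \<Rightarrow> ('r \<times> 'r) set \<Rightarrow> 'm \<Rightarrow> 'm" where
  "difference_action R V d v =
     (case SOME (r, s). r \<in> carrier R \<and> s \<in> carrier R \<and> diff R r s = d of
        (r, s) \<Rightarrow> r \<odot>\<^bsub>V\<^esub> v \<ominus>\<^bsub>V\<^esub> s \<odot>\<^bsub>V\<^esub> v)"

definition difference_ring :: "('r, 'x) ring_scheme \<Rightarrow> ('r \<times> 'r) set ring" where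
  "difference_ring R =
     \<lparr>carrier = carrier (difference_module (regular_module R)),
      mult = difference_action R (difference_module (regular_module R)), one = diff R \<one>\<^bsub>R\<^esub> \<zero>\<^bsub>R\<^esub>,
      zero = \<zero>\<^bsub>difference_module (regular_module R)\<^esub>,
      add = add (difference_module (regular_module R))\<rparr>"

definition extended_module ::
    "('r, 'x) ring_scheme \<Rightarrow> ('r, 'm, 'y) module_scheme \<Rightarrow> (('r \<times> 'r) set, 'm) module" where
  "extended_module R V =
     \<lparr>carrier = carrier V, mult = mult V, one = \<one>\<^bsub>V\<^esub>, zero = \<zero>\<^bsub>V\<^esub>, add = add V,
      smult = difference_action R V\<rparr>"

lemma diff_regular_module [simp]: "diff (regular_module R) = diff R"
  by (simp add: fun_eq_iff diff_def same_difference_def regular_module_def)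

lemma regular_module_simps [simp]:
  "carrier (regular_module R) = carrier R" "add (regular_module R) = add R"
  "\<zero>\<^bsub>regular_module R\<^esub> = \<zero>\<^bsub>R\<^esub>" "smult (regular_module R) = mult R"
  by (simp_all add: regular_module_def)

lemma extended_module_simps [simp]:
  "carrier (extended_module R V) = carrier V" "add (extended_module R V) = add V"
  "\<zero>\<^bsub>extended_module R V\<^esub> = \<zero>\<^bsub>V\<^esub>"
  by (simp_all add: extended_module_def)

lemma (in semiring) semimodule_regular: "semimodule R (regular_module R)"
proof -
  have "abelian_monoid (regular_module R)"
    by (rule abelian_monoidI) (simp_all add: a_ac)
  moreover have "semimodule_axioms R (regular_module R)"
    by unfold_locales (simp_all add: m_assoc l_distr r_distr)
  ultimately show ?thesis
    by (intro semimodule.intro semiring_axioms)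
qed

locale semimodule_group = semimodule R M + M?: abelian_group M
  for R (structure) and M (structure)
begin

lemma smult_r_minus:
  assumes "r \<in> carrier R" "v \<in> carrier M"
  shows "r \<odot>\<^bsub>M\<^esub> (\<ominus>\<^bsub>M\<^esub> v) = \<ominus>\<^bsub>M\<^esub> (r \<odot>\<^bsub>M\<^esub> v)"
proof (rule M.minus_equality[symmetric])
  show "r \<odot>\<^bsub>M\<^esub> (\<ominus>\<^bsub>M\<^esub> v) \<oplus>\<^bsub>M\<^esub> r \<odot>\<^bsub>M\<^esub> v = \<zero>\<^bsub>M\<^esub>"
    using assms by (simp add: smult_r_distr[symmetric] M.l_neg)
qed (use assms in auto)

text \<open>
  The element \<open>x\<close> that witnesses equality of two differences acts by a summand \<open>x v\<close> on both sides,
  and this summand cancels because the action takes place in a group.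
\<close>

lemma difference_action_diff:
  assumes [simp]: "r \<in> carrier R" "s \<in> carrier R" "v \<in> carrier M"
  shows "difference_action R M (diff R r s) v = r \<odot>\<^bsub>M\<^esub> v \<ominus>\<^bsub>M\<^esub> s \<odot>\<^bsub>M\<^esub> v"
proof -
  interpret reg: semimodule R "regular_module R"
    by (rule R.semimodule_regular)
  obtain p q where pq: "(SOME (p, q). p \<in> carrier R \<and> q \<in> carrier R \<and> diff R p q = diff R r s) = (p, q)"
    by fastforce
  have "(case (p, q) of (p, q) \<Rightarrow> p \<in> carrier R \<and> q \<in> carrier R \<and> diff R p q = diff R r s)"
    unfolding pq[symmetric] by (rule someI[of _ "(r, s)"]) simp
  then have [simp]: "p \<in> carrier R" "q \<in> carrier R" and eq: "diff R p q = diff R r s"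
    by auto
  then obtain x where [simp]: "x \<in> carrier R" and x: "p \<oplus>\<^bsub>R\<^esub> s \<oplus>\<^bsub>R\<^esub> x = r \<oplus>\<^bsub>R\<^esub> q \<oplus>\<^bsub>R\<^esub> x"
    using reg.diff_eq_iff[of p q r s] by auto
  have "p \<odot>\<^bsub>M\<^esub> v \<oplus>\<^bsub>M\<^esub> s \<odot>\<^bsub>M\<^esub> v \<oplus>\<^bsub>M\<^esub> x \<odot>\<^bsub>M\<^esub> v = r \<odot>\<^bsub>M\<^esub> v \<oplus>\<^bsub>M\<^esub> q \<odot>\<^bsub>M\<^esub> v \<oplus>\<^bsub>M\<^esub> x \<odot>\<^bsub>M\<^esub> v"
    using arg_cong[OF x, of "\<lambda>z. z \<odot>\<^bsub>M\<^esub> v"] by (simp add: smult_l_distr)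
  then have "p \<odot>\<^bsub>M\<^esub> v \<oplus>\<^bsub>M\<^esub> s \<odot>\<^bsub>M\<^esub> v = r \<odot>\<^bsub>M\<^esub> v \<oplus>\<^bsub>M\<^esub> q \<odot>\<^bsub>M\<^esub> v"
    by simp
  then have "p \<odot>\<^bsub>M\<^esub> v = r \<odot>\<^bsub>M\<^esub> v \<oplus>\<^bsub>M\<^esub> q \<odot>\<^bsub>M\<^esub> v \<oplus>\<^bsub>M\<^esub> \<ominus>\<^bsub>M\<^esub> (s \<odot>\<^bsub>M\<^esub> v)"
    by (simp add: M.add.inv_solve_right)
  then have "p \<odot>\<^bsub>M\<^esub> v \<ominus>\<^bsub>M\<^esub> q \<odot>\<^bsub>M\<^esub> v = r \<odot>\<^bsub>M\<^esub> v \<ominus>\<^bsub>M\<^esub> s \<odot>\<^bsub>M\<^esub> v"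
    by (simp add: M.minus_eq M.a_assoc M.a_comm[of "\<ominus>\<^bsub>M\<^esub> (s \<odot>\<^bsub>M\<^esub> v)"] M.r_neg2)
  then show ?thesis
    by (simp add: difference_action_def pq)
qed

end

lemma (in semimodule) semimodule_group_difference_module: "semimodule_group R (difference_module M)"
  by (intro semimodule_group.intro semimodule_difference_module abelian_group_difference_module)

context semiring
begin

interpretation reg: semimodule R "regular_module R"
  by (rule semimodule_regular)

interpretation D: semimodule_group R "difference_module (regular_module R)"
  by (rule reg.semimodule_group_difference_module)

lemma difference_ring_closed [simp, intro]:
  "a \<in> carrier R \<Longrightarrow> b \<in> carrier R \<Longrightarrow> diff R a b \<in> carrier (difference_ring R)"
  using reg.diff_closed[of a b] by (simp add: difference_ring_def)

lemma difference_ring_cases: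
  assumes "x \<in> carrier (difference_ring R)"
  obtains a b where "a \<in> carrier R" "b \<in> carrier R" "x = diff R a b"
  using assms reg.diff_cases[of x] by (auto simp: difference_ring_def)

lemma difference_ring_eq_iff:
  assumes "a \<in> carrier R" "b \<in> carrier R" "c \<in> carrier R" "d \<in> carrier R"
  shows "diff R a b = diff R c d \<longleftrightarrow> (\<exists>x\<in>carrier R. a \<oplus> d \<oplus> x = c \<oplus> b \<oplus> x)"
  using reg.diff_eq_iff[of a b c d] assms by simp

lemma difference_ring_add:
  assumes "a \<in> carrier R" "b \<in> carrier R" "c \<in> carrier R" "d \<in> carrier R"
  shows "diff R a b \<oplus>\<^bsub>difference_ring R\<^esub> diff R c d = diff R (a \<oplus> c) (b \<oplus> d)"
  using reg.diff_add[of a b c d] assms by (simp add: difference_ring_def)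

lemma difference_ring_zero: "\<zero>\<^bsub>difference_ring R\<^esub> = diff R \<zero> \<zero>"
  using reg.diff_zero by (simp add: difference_ring_def)

lemma difference_ring_one: "\<one>\<^bsub>difference_ring R\<^esub> = diff R \<one> \<zero>"
  by (simp add: difference_ring_def)

lemma difference_ring_mult:
  assumes "a \<in> carrier R" "b \<in> carrier R" "c \<in> carrier R" "d \<in> carrier R"
  shows "diff R a b \<otimes>\<^bsub>difference_ring R\<^esub> diff R c d = diff R (a \<otimes> c \<oplus> b \<otimes> d) (a \<otimes> d \<oplus> b \<otimes> c)"
  using assms D.difference_action_diff[of a b "diff R c d"] reg.diff_closed[of c d]
    reg.diff_smult[of a c d] reg.diff_smult[of b c d]
    reg.diff_minus[of "b \<otimes> c" "b \<otimes> d"] reg.diff_add[of "a \<otimes> c" "a \<otimes> d" "b \<otimes> d" "b \<otimes> c"]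
  by (simp add: difference_ring_def a_minus_def)

lemma ring_difference_ring: "ring (difference_ring R)"
proof (rule ringI)
  show "abelian_group (difference_ring R)"
    using abelian_groupE[OF D.abelian_group_axioms]
    by (intro abelian_groupI) (simp_all add: difference_ring_def)
  show "monoid (difference_ring R)"
    by (rule monoidI)
      (auto elim!: difference_ring_cases
        simp: difference_ring_one difference_ring_mult l_distr r_distr m_assoc a_ac)
qed (auto elim!: difference_ring_cases
      simp: difference_ring_add difference_ring_mult l_distr r_distr a_ac)

lemma difference_ring_minus:
  assumes "a \<in> carrier R" "b \<in> carrier R"
  shows "\<ominus>\<^bsub>difference_ring R\<^esub> diff R a b = diff R b a"
proof -
  interpret D: ring "difference_ring R"
    by (rule ring_difference_ring)
  have "diff R b a \<oplus>\<^bsub>difference_ring R\<^esub> diff R a b = \<zero>\<^bsub>difference_ring R\<^esub>"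
    using assms by (auto simp: difference_ring_add difference_ring_zero difference_ring_eq_iff a_ac)
  then show ?thesis
    using assms by (intro D.minus_equality) auto
qed

end

context semimodule_group
begin

lemma smult_extended_module:
  assumes "r \<in> carrier R" "s \<in> carrier R" "v \<in> carrier M"
  shows "diff R r s \<odot>\<^bsub>extended_module R M\<^esub> v = r \<odot>\<^bsub>M\<^esub> v \<ominus>\<^bsub>M\<^esub> s \<odot>\<^bsub>M\<^esub> v"
  using difference_action_diff[OF assms] by (simp add: extended_module_def)

text \<open>
  The passage from semimodules to modules: an abelian group with an action of the semiring is a
  module over its ring of differences.
\<close>

lemma semimodule_group_extended_module:
  "semimodule_group (difference_ring R) (extended_module R M)"
proof -
  interpret D: ring "difference_ring R"
    by (rule R.ring_difference_ring)
  have group: "abelian_group (extended_module R M)"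
    using abelian_groupE[OF M.abelian_group_axioms]
    by (intro abelian_groupI) (simp_all add: extended_module_def)
  note act = difference_action_diff R.difference_ring_add R.difference_ring_mult
    R.difference_ring_zero R.difference_ring_one
  have "semimodule_axioms (difference_ring R) (extended_module R M)"
    by unfold_locales
      (auto elim!: R.difference_ring_cases simp: extended_module_def act smult_assoc
        smult_r_distr smult_l_distr smult_r_minus M.minus_eq M.minus_add M.a_ac)
  then show ?thesis
    by (intro semimodule_group.intro semimodule.intro D.semiring_axioms group
        abelian_group.axioms(1))
qed

end

section \<open>The Jacobson radical of a ring\<close>

text \<open>
  The Jacobson radical of a ring, in the elementwise form that refers to right inverses. The lemma
  \<open>mem_radical_iff_left_invertible\<close> shows that left inverses give the same set.
\<close>

definition ring_radical :: "('a, 'x) ring_scheme \<Rightarrow> 'a set" where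
  "ring_radical D =
     {a \<in> carrier D. \<forall>x\<in>carrier D. \<exists>u\<in>carrier D. (\<one>\<^bsub>D\<^esub> \<oplus>\<^bsub>D\<^esub> a \<otimes>\<^bsub>D\<^esub> x) \<otimes>\<^bsub>D\<^esub> u = \<one>\<^bsub>D\<^esub>}"

definition opposite_ring :: "('a, 'x) ring_scheme \<Rightarrow> 'a ring" where
  "opposite_ring D =
     \<lparr>carrier = carrier D, mult = (\<lambda>x y. y \<otimes>\<^bsub>D\<^esub> x), one = \<one>\<^bsub>D\<^esub>, zero = \<zero>\<^bsub>D\<^esub>, add = add D\<rparr>"

context ring
begin

lemma ring_opposite_ring: "ring (opposite_ring R)"
proof (rule ringI)
  show "abelian_group (opposite_ring R)"
    using abelian_groupE[OF is_abelian_group]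
    by (intro abelian_groupI) (simp_all add: opposite_ring_def)
  show "monoid (opposite_ring R)"
    by (rule monoidI) (simp_all add: opposite_ring_def m_assoc)
qed (simp_all add: opposite_ring_def l_distr r_distr)

text \<open>
  The right inverse \<open>u\<close> of \<open>1 + a x\<close> has the form \<open>1 + a y\<close>, so it has a right inverse as well and
  is therefore a two-sided inverse. An inverse \<open>u\<close> of \<open>1 + a x\<close> yields the inverse \<open>1 - x u a\<close> of
  \<open>1 + x a\<close>.
\<close>

lemma radical_left_invertible:
  assumes "a \<in> ring_radical R" and x [simp]: "x \<in> carrier R"
  obtains u where "u \<in> carrier R" "u \<otimes> (\<one> \<oplus> x \<otimes> a) = \<one>"
proof -
  from assms(1) have a [simp]: "a \<in> carrier R"
    and inv: "\<And>y. y \<in> carrier R \<Longrightarrow> \<exists>u\<in>carrier R. (\<one> \<oplus> a \<otimes> y) \<otimes> u = \<one>"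
    by (auto simp: ring_radical_def)
  from inv[OF x] obtain u where u [simp]: "u \<in> carrier R" and 1: "(\<one> \<oplus> a \<otimes> x) \<otimes> u = \<one>"
    by auto
  have "u = (\<one> \<oplus> a \<otimes> x) \<otimes> u \<ominus> a \<otimes> x \<otimes> u"
    using x a u by algebra
  also have "\<dots> = \<one> \<oplus> a \<otimes> (\<ominus> (x \<otimes> u))"
    unfolding 1 using x a u by algebra
  finally have u_eq: "u = \<one> \<oplus> a \<otimes> (\<ominus> (x \<otimes> u))" .
  obtain w where w [simp]: "w \<in> carrier R" and 2: "u \<otimes> w = \<one>"
    using inv[of "\<ominus> (x \<otimes> u)"] unfolding u_eq[symmetric] by auto
  have "w = (\<one> \<oplus> a \<otimes> x) \<otimes> u \<otimes> w"
    unfolding 1 by simp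
  also have "\<dots> = (\<one> \<oplus> a \<otimes> x) \<otimes> (u \<otimes> w)"
    by (simp add: m_assoc)
  finally have "w = \<one> \<oplus> a \<otimes> x"
    unfolding 2 by simp
  with 2 have 3: "u \<otimes> (\<one> \<oplus> a \<otimes> x) = \<one>"
    by simp
  have "(\<one> \<ominus> x \<otimes> u \<otimes> a) \<otimes> (\<one> \<oplus> x \<otimes> a) = \<one> \<oplus> x \<otimes> a \<ominus> x \<otimes> (u \<otimes> (\<one> \<oplus> a \<otimes> x)) \<otimes> a"
    using x a u by (simp add: minus_eq l_distr r_distr l_minus r_minus m_assoc minus_add a_ac)
  also have "\<dots> = \<one>"
    unfolding 3 using x a by algebra
  finally show ?thesis
    by (rule that[rotated]) simp
qed

text \<open>
  The previous lemma, applied to the opposite ring, gives its own converse. Both directions matter: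
  Nakayama's lemma uses left inverses of \<open>1 + x a\<close> for \<open>a\<close> in the radical, and an element outside
  the radical must generate a proper left ideal \<open>D (1 + x a)\<close>.
\<close>

lemma mem_radical_iff_left_invertible:
  "a \<in> ring_radical R \<longleftrightarrow>
     a \<in> carrier R \<and> (\<forall>x\<in>carrier R. \<exists>u\<in>carrier R. u \<otimes> (\<one> \<oplus> x \<otimes> a) = \<one>)" (is "_ \<longleftrightarrow> ?left")
proof
  assume "a \<in> ring_radical R"
  then show ?left
    using radical_left_invertible by (auto simp: ring_radical_def) metis
next
  assume ?left
  then have "a \<in> ring_radical (opposite_ring R)"
    by (simp add: ring_radical_def opposite_ring_def)
  from ring.radical_left_invertible[OF ring_opposite_ring this] \<open>?left\<close>
  show "a \<in> ring_radical R"
    by (auto simp: ring_radical_def opposite_ring_def) metis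
qed

lemma radical_subset: "a \<in> ring_radical R \<Longrightarrow> a \<in> carrier R"
  by (simp add: ring_radical_def)

lemma radical_mult_right:
  "a \<in> ring_radical R \<Longrightarrow> y \<in> carrier R \<Longrightarrow> a \<otimes> y \<in> ring_radical R"
  by (simp add: ring_radical_def m_assoc)

lemma radical_mult_left:
  "a \<in> ring_radical R \<Longrightarrow> y \<in> carrier R \<Longrightarrow> y \<otimes> a \<in> ring_radical R"
  by (simp add: mem_radical_iff_left_invertible m_assoc[symmetric])

text \<open>
  If \<open>u\<close> is a right inverse of \<open>1 + a x\<close>, then \<open>(1 + (a + b) x) u = 1 + b (x u)\<close>, which has a right
  inverse since \<open>b\<close> is in the radical.
\<close>

lemma radical_add:
  assumes "a \<in> ring_radical R" "b \<in> ring_radical R"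
  shows "a \<oplus> b \<in> ring_radical R"
proof -
  have [simp]: "a \<in> carrier R" "b \<in> carrier R"
    using assms by (auto intro: radical_subset)
  have "\<exists>u\<in>carrier R. (\<one> \<oplus> (a \<oplus> b) \<otimes> x) \<otimes> u = \<one>" if x [simp]: "x \<in> carrier R" for x
  proof -
    from assms(1) x obtain u where u [simp]: "u \<in> carrier R" "(\<one> \<oplus> a \<otimes> x) \<otimes> u = \<one>"
      unfolding ring_radical_def by blast
    have "x \<otimes> u \<in> carrier R"
      by simp
    with assms(2) obtain w where w [simp]: "w \<in> carrier R"
      and *: "(\<one> \<oplus> b \<otimes> (x \<otimes> u)) \<otimes> w = \<one>"
      unfolding ring_radical_def by blast
    have "(\<one> \<oplus> (a \<oplus> b) \<otimes> x) \<otimes> (u \<otimes> w) = ((\<one> \<oplus> a \<otimes> x) \<otimes> u \<oplus> b \<otimes> (x \<otimes> u)) \<otimes> w"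
      using \<open>a \<in> carrier R\<close> \<open>b \<in> carrier R\<close> x u(1) w by algebra
    with * show ?thesis
      by (auto intro!: bexI[of _ "u \<otimes> w"])
  qed
  then show ?thesis
    by (simp add: ring_radical_def)
qed

lemma zero_in_radical: "\<zero> \<in> ring_radical R"
  by (auto simp: ring_radical_def)

lemma radical_minus: "a \<in> ring_radical R \<Longrightarrow> \<ominus> a \<in> ring_radical R"
  using radical_mult_right[of a "\<ominus> \<one>"] radical_subset[of a] by (simp add: r_minus)

end

section \<open>Nakayama's lemma\<close>

lemma (in semimodule) smult_finsum:
  "finite A \<Longrightarrow> r \<in> carrier R \<Longrightarrow> f \<in> A \<rightarrow> carrier M \<Longrightarrow>
     r \<odot>\<^bsub>M\<^esub> (\<Oplus>\<^bsub>M\<^esub>i\<in>A. f i) = (\<Oplus>\<^bsub>M\<^esub>i\<in>A. r \<odot>\<^bsub>M\<^esub> f i)"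
  by (induction A rule: finite_induct) (simp_all add: smult_r_distr Pi_def)

lemma (in semimodule) finsum_smult_add:
  fixes n :: nat
  assumes "a \<in> {..<n} \<rightarrow> carrier R" "b \<in> {..<n} \<rightarrow> carrier R" "g \<in> {..<n} \<rightarrow> carrier M"
  shows "(\<Oplus>\<^bsub>M\<^esub>i\<in>{..<n}. a i \<odot>\<^bsub>M\<^esub> g i) \<oplus>\<^bsub>M\<^esub> (\<Oplus>\<^bsub>M\<^esub>i\<in>{..<n}. b i \<odot>\<^bsub>M\<^esub> g i) =
    (\<Oplus>\<^bsub>M\<^esub>i\<in>{..<n}. (a i \<oplus>\<^bsub>R\<^esub> b i) \<odot>\<^bsub>M\<^esub> g i)"
proof -
  have "(\<Oplus>\<^bsub>M\<^esub>i\<in>{..<n}. (a i \<oplus>\<^bsub>R\<^esub> b i) \<odot>\<^bsub>M\<^esub> g i) =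
      (\<Oplus>\<^bsub>M\<^esub>i\<in>{..<n}. a i \<odot>\<^bsub>M\<^esub> g i \<oplus>\<^bsub>M\<^esub> b i \<odot>\<^bsub>M\<^esub> g i)"
    using assms by (intro M.finsum_cong') (auto simp: smult_l_distr Pi_def)
  also have "\<dots> = (\<Oplus>\<^bsub>M\<^esub>i\<in>{..<n}. a i \<odot>\<^bsub>M\<^esub> g i) \<oplus>\<^bsub>M\<^esub> (\<Oplus>\<^bsub>M\<^esub>i\<in>{..<n}. b i \<odot>\<^bsub>M\<^esub> g i)"
    using assms by (intro M.finsum_addf) (auto simp: Pi_def)
  finally show ?thesis ..
qed

lemma (in semimodule) smult_finsum_smult:
  fixes n :: nat
  assumes "c \<in> carrier R" "a \<in> {..<n} \<rightarrow> carrier R" "g \<in> {..<n} \<rightarrow> carrier M"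
  shows "c \<odot>\<^bsub>M\<^esub> (\<Oplus>\<^bsub>M\<^esub>i\<in>{..<n}. a i \<odot>\<^bsub>M\<^esub> g i) = (\<Oplus>\<^bsub>M\<^esub>i\<in>{..<n}. (c \<otimes>\<^bsub>R\<^esub> a i) \<odot>\<^bsub>M\<^esub> g i)"
proof -
  have "c \<odot>\<^bsub>M\<^esub> (\<Oplus>\<^bsub>M\<^esub>i\<in>{..<n}. a i \<odot>\<^bsub>M\<^esub> g i) = (\<Oplus>\<^bsub>M\<^esub>i\<in>{..<n}. c \<odot>\<^bsub>M\<^esub> (a i \<odot>\<^bsub>M\<^esub> g i))"
    using assms by (intro smult_finsum) (auto simp: Pi_def)
  also have "\<dots> = (\<Oplus>\<^bsub>M\<^esub>i\<in>{..<n}. (c \<otimes>\<^bsub>R\<^esub> a i) \<odot>\<^bsub>M\<^esub> g i)"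
    using assms by (intro M.finsum_cong') (auto simp: smult_assoc Pi_def)
  finally show ?thesis .
qed

lemma (in abelian_monoid) finsum_lessThan_Suc:
  "f \<in> {..<Suc n} \<rightarrow> carrier G \<Longrightarrow>
     (\<Oplus>i\<in>{..<Suc n}. f i) = f n \<oplus> (\<Oplus>i\<in>{..<n}. f i)"
  by (simp add: lessThan_Suc Pi_def)

text \<open>
  Nakayama's lemma in the form that suits an induction: if each \<open>g i\<close> is a combination of all of
  them with coefficients in the radical, they vanish. In the relation for the last one, the term
  with \<open>g n\<close> is moved to the left, where its coefficient \<open>1 - b n\<close> has a left inverse; thus
  \<open>g n\<close> is a radical combination of the others and can be eliminated from their relations.
\<close>

lemma nakayama:
  fixes D (structure) and V (structure) and n :: nat
  assumes "ring D" "semimodule_group D V"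
    and "g \<in> {..<n} \<rightarrow> carrier V"
    and "\<And>i. i < n \<Longrightarrow> \<exists>b \<in> {..<n} \<rightarrow> ring_radical D. g i = (\<Oplus>\<^bsub>V\<^esub>j\<in>{..<n}. b j \<odot>\<^bsub>V\<^esub> g j)"
    and "i < n"
  shows "g i = \<zero>\<^bsub>V\<^esub>"
  using assms(3-)
proof (induction n arbitrary: i)
  case 0
  then show ?case by simp
next
  case (Suc n)
  interpret D: ring D by fact
  interpret V: semimodule_group D V by fact
  note rad = D.radical_subset
  have g [simp]: "g j \<in> carrier V" if "j \<le> n" for j
    using Suc.prems(1) that by (auto simp: Pi_def)
  have gn: "g \<in> {..<n} \<rightarrow> carrier V" by auto
  from Suc.prems(2)[of n] obtain b where b: "b \<in> {..<Suc n} \<rightarrow> ring_radical D"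
    and g_sum: "g n = (\<Oplus>\<^bsub>V\<^esub>j\<in>{..<Suc n}. b j \<odot>\<^bsub>V\<^esub> g j)"
    by auto
  have b_rad: "b j \<in> ring_radical D" if "j \<le> n" for j
    using b that by (auto simp: Pi_def)
  then have [simp]: "b j \<in> carrier D" if "j \<le> n" for j
    using that rad by blast
  define s where "s = (\<Oplus>\<^bsub>V\<^esub>j\<in>{..<n}. b j \<odot>\<^bsub>V\<^esub> g j)"
  have g_eq: "g n = b n \<odot>\<^bsub>V\<^esub> g n \<oplus>\<^bsub>V\<^esub> s"
    unfolding s_def by (subst (1) g_sum, rule V.M.finsum_lessThan_Suc) auto
  have [simp]: "s \<in> carrier V"
    unfolding s_def by (intro V.M.finsum_closed) auto
  obtain u where [simp]: "u \<in> carrier D" and u: "u \<otimes> (\<one> \<oplus> (\<ominus> \<one>) \<otimes> b n) = \<one>"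
    using D.radical_left_invertible[OF b_rad, of n "\<ominus> \<one>"] by auto
  have "g n \<oplus>\<^bsub>V\<^esub> ((\<ominus> \<one>) \<otimes> b n) \<odot>\<^bsub>V\<^esub> g n =
      s \<oplus>\<^bsub>V\<^esub> (b n \<oplus> (\<ominus> \<one>) \<otimes> b n) \<odot>\<^bsub>V\<^esub> g n"
    by (subst (1) g_eq) (simp add: V.smult_l_distr V.M.a_ac)
  also have "b n \<oplus> (\<ominus> \<one>) \<otimes> b n = \<zero>"
    by (simp add: D.l_minus D.r_neg)
  finally have "(\<one> \<oplus> (\<ominus> \<one>) \<otimes> b n) \<odot>\<^bsub>V\<^esub> g n = s"
    by (simp add: V.smult_l_distr)
  then have "u \<odot>\<^bsub>V\<^esub> s = (u \<otimes> (\<one> \<oplus> (\<ominus> \<one>) \<otimes> b n)) \<odot>\<^bsub>V\<^esub> g n"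
    by (subst V.smult_assoc) simp_all
  then have "g n = u \<odot>\<^bsub>V\<^esub> s"
    unfolding u by simp
  also have "\<dots> = (\<Oplus>\<^bsub>V\<^esub>j\<in>{..<n}. (u \<otimes> b j) \<odot>\<^bsub>V\<^esub> g j)"
    unfolding s_def by (rule V.smult_finsum_smult) auto
  finally have gn_eq: "g n = (\<Oplus>\<^bsub>V\<^esub>j\<in>{..<n}. (u \<otimes> b j) \<odot>\<^bsub>V\<^esub> g j)" .
  \<comment> \<open>eliminating \<open>g n\<close> leaves relations with coefficients \<open>c k + c n u b k\<close>, still in the radical\<close>
  have small: "g j = \<zero>\<^bsub>V\<^esub>" if "j < n" for j
  proof (rule Suc.IH[OF gn _ that])
    fix j assume "j < n"
    with Suc.prems(2)[of j] obtain c where c: "c \<in> {..<Suc n} \<rightarrow> ring_radical D"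
      and g_j: "g j = (\<Oplus>\<^bsub>V\<^esub>k\<in>{..<Suc n}. c k \<odot>\<^bsub>V\<^esub> g k)"
      by auto
    have c_rad: "c k \<in> ring_radical D" if "k \<le> n" for k
      using c that by (auto simp: Pi_def)
    then have [simp]: "c k \<in> carrier D" if "k \<le> n" for k
      using that rad by blast
    have "g j = c n \<odot>\<^bsub>V\<^esub> g n \<oplus>\<^bsub>V\<^esub> (\<Oplus>\<^bsub>V\<^esub>k\<in>{..<n}. c k \<odot>\<^bsub>V\<^esub> g k)"
      unfolding g_j by (rule V.M.finsum_lessThan_Suc) auto
    also have "c n \<odot>\<^bsub>V\<^esub> g n = (\<Oplus>\<^bsub>V\<^esub>k\<in>{..<n}. (c n \<otimes> (u \<otimes> b k)) \<odot>\<^bsub>V\<^esub> g k)"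
      unfolding gn_eq by (rule V.smult_finsum_smult) auto
    also have "\<dots> \<oplus>\<^bsub>V\<^esub> (\<Oplus>\<^bsub>V\<^esub>k\<in>{..<n}. c k \<odot>\<^bsub>V\<^esub> g k) =
        (\<Oplus>\<^bsub>V\<^esub>k\<in>{..<n}. (c n \<otimes> (u \<otimes> b k) \<oplus> c k) \<odot>\<^bsub>V\<^esub> g k)"
      by (rule V.finsum_smult_add) auto
    finally show "\<exists>b \<in> {..<n} \<rightarrow> ring_radical D. g j = (\<Oplus>\<^bsub>V\<^esub>k\<in>{..<n}. b k \<odot>\<^bsub>V\<^esub> g k)"
      by (intro bexI[of _ "\<lambda>k. c n \<otimes> (u \<otimes> b k) \<oplus> c k"])
        (auto intro!: D.radical_add D.radical_mult_left b_rad c_rad)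
  qed
  have "(\<Oplus>\<^bsub>V\<^esub>j\<in>{..<n}. (u \<otimes> b j) \<odot>\<^bsub>V\<^esub> g j) = (\<Oplus>\<^bsub>V\<^esub>j\<in>{..<n}. \<zero>\<^bsub>V\<^esub>)"
    by (rule V.M.finsum_cong') (auto simp: small)
  then have "g n = \<zero>\<^bsub>V\<^esub>"
    using gn_eq by simp
  then show ?case
    using small Suc.prems(3) by (cases "i = n") auto
qed

section \<open>The radical of a semiring and of its ring of differences\<close>

context semiring
begin

interpretation D: ring "difference_ring R"
  by (rule ring_difference_ring)

text \<open>
  In the ring of differences the condition of right semiregularity reads \<open>i + j + i j = 0\<close> for
  \<open>i = i1 - i2\<close> and \<open>j = j1 - j2\<close>, that is, \<open>(1 + i) (1 + j) = 1\<close>.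
\<close>

lemma right_semiregular_imp_radical:
  assumes K: "right_ideal R K" "right_semiregular R K" and k: "k \<in> K"
  shows "diff R k \<zero> \<in> ring_radical (difference_ring R)"
proof -
  have mem: "a \<in> carrier R" if "a \<in> K" for a
    using K(1) that by (auto simp: right_ideal_def)
  have "\<exists>u\<in>carrier (difference_ring R). (\<one>\<^bsub>difference_ring R\<^esub> \<oplus>\<^bsub>difference_ring R\<^esub>
        diff R k \<zero> \<otimes>\<^bsub>difference_ring R\<^esub> x) \<otimes>\<^bsub>difference_ring R\<^esub> u = \<one>\<^bsub>difference_ring R\<^esub>"
    if x: "x \<in> carrier (difference_ring R)" for x
  proof -
    from x obtain p q where [simp]: "p \<in> carrier R" "q \<in> carrier R" and "x = diff R p q"
      by (rule difference_ring_cases)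
    define i1 i2 where i: "i1 = k \<otimes> p" "i2 = k \<otimes> q"
    have "i1 \<in> K" "i2 \<in> K"
      using K(1) k by (auto simp: right_ideal_def i)
    with K(2) obtain j1 j2 where j: "j1 \<in> K" "j2 \<in> K"
      and eq: "i1 \<oplus> j1 \<oplus> i1 \<otimes> j1 \<oplus> i2 \<otimes> j2 = i2 \<oplus> j2 \<oplus> i1 \<otimes> j2 \<oplus> i2 \<otimes> j1"
      unfolding right_semiregular_def by blast
    note [simp] = mem[OF \<open>i1 \<in> K\<close>] mem[OF \<open>i2 \<in> K\<close>] mem[OF j(1)] mem[OF j(2)] mem[OF k]
    have x_eq: "\<one>\<^bsub>difference_ring R\<^esub> \<oplus>\<^bsub>difference_ring R\<^esub> diff R k \<zero> \<otimes>\<^bsub>difference_ring R\<^esub> x =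
        diff R (\<one> \<oplus> i1) i2"
      by (simp add: \<open>x = diff R p q\<close> i difference_ring_one difference_ring_mult difference_ring_add)
    have "(\<one> \<oplus> i1) \<otimes> (\<one> \<oplus> j1) \<oplus> i2 \<otimes> j2 = \<one> \<oplus> (i1 \<oplus> j1 \<oplus> i1 \<otimes> j1 \<oplus> i2 \<otimes> j2)"
      by (simp add: l_distr r_distr a_ac)
    also have "\<dots> = \<one> \<oplus> ((\<one> \<oplus> i1) \<otimes> j2 \<oplus> i2 \<otimes> (\<one> \<oplus> j1))"
      unfolding eq by (simp add: l_distr r_distr a_ac)
    finally have "diff R (\<one> \<oplus> i1) i2 \<otimes>\<^bsub>difference_ring R\<^esub> diff R (\<one> \<oplus> j1) j2 = \<one>\<^bsub>difference_ring R\<^esub>"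
      by (auto simp: difference_ring_mult difference_ring_one difference_ring_eq_iff intro: exI[of _ \<zero>])
    then show ?thesis
      unfolding x_eq by (auto intro!: bexI[of _ "diff R (\<one> \<oplus> j1) j2"])
  qed
  then show ?thesis
    using mem[OF k] by (simp add: ring_radical_def)
qed

lemma right_ideal_radical_preimage:
  "right_ideal R {a \<in> carrier R. diff R a \<zero> \<in> ring_radical (difference_ring R)}"
  unfolding right_ideal_def
proof (intro conjI ballI)
  show "\<zero> \<in> {a \<in> carrier R. diff R a \<zero> \<in> ring_radical (difference_ring R)}"
    using D.zero_in_radical by (simp add: difference_ring_zero)
next
  fix a b
  assume "a \<in> {a \<in> carrier R. diff R a \<zero> \<in> ring_radical (difference_ring R)}"
    and "b \<in> {a \<in> carrier R. diff R a \<zero> \<in> ring_radical (difference_ring R)}"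
  then show "a \<oplus> b \<in> {a \<in> carrier R. diff R a \<zero> \<in> ring_radical (difference_ring R)}"
    using D.radical_add[of "diff R a \<zero>" "diff R b \<zero>"] by (simp add: difference_ring_add)
next
  fix r a
  assume "r \<in> carrier R" "a \<in> {a \<in> carrier R. diff R a \<zero> \<in> ring_radical (difference_ring R)}"
  then show "a \<otimes> r \<in> {a \<in> carrier R. diff R a \<zero> \<in> ring_radical (difference_ring R)}"
    using D.radical_mult_right[of "diff R a \<zero>" "diff R r \<zero>"] by (simp add: difference_ring_mult)
qed auto

text \<open>
  Right semiregularity asks for an equation in \<open>R\<close> itself, while invertibility in the ring of
  differences gives it only up to a common summand \<open>z\<close>, which need not lie in \<open>K\<close>. So \<open>A + z = B + z\<close>,
  where \<open>A\<close> and \<open>B\<close> are the two sides for the candidates \<open>c1\<close> and \<open>c2\<close>. The candidates are corrected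
  by adding the opposite sides \<open>B\<close> and \<open>A\<close> and the common element \<open>e = i1 z + i2 z\<close> of \<open>K\<close>. Both sides
  then contain \<open>A + B + e\<close>, and the products \<open>i1 z\<close> and \<open>i2 z\<close> supplied by \<open>e\<close> allow \<open>A\<close> and \<open>B\<close> to be
  exchanged in the remaining terms, because \<open>i A + i z = i B + i z\<close>.
\<close>

lemma right_semiregular_radical_preimage:
  "right_semiregular R {a \<in> carrier R. diff R a \<zero> \<in> ring_radical (difference_ring R)}"
proof -
  define K where "K = {a \<in> carrier R. diff R a \<zero> \<in> ring_radical (difference_ring R)}"
  have K_carrier: "a \<in> carrier R" if "a \<in> K" for a
    using that by (simp add: K_def)
  have K_rad: "diff R a \<zero> \<in> ring_radical (difference_ring R)" if "a \<in> K" for a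
    using that by (simp add: K_def)
  have K_add: "a \<oplus> b \<in> K" if "a \<in> K" "b \<in> K" for a b
    using right_ideal_radical_preimage that unfolding right_ideal_def K_def by blast
  have K_mult: "a \<otimes> r \<in> K" if "a \<in> K" "r \<in> carrier R" for a r
    using right_ideal_radical_preimage that unfolding right_ideal_def K_def by blast
  have "\<exists>j1\<in>K. \<exists>j2\<in>K. i1 \<oplus> j1 \<oplus> i1 \<otimes> j1 \<oplus> i2 \<otimes> j2 = i2 \<oplus> j2 \<oplus> i1 \<otimes> j2 \<oplus> i2 \<otimes> j1"
    if i [simp]: "i1 \<in> K" "i2 \<in> K" for i1 i2
  proof -
    note [simp] = K_carrier
    have "diff R i1 \<zero> \<oplus>\<^bsub>difference_ring R\<^esub> (\<ominus>\<^bsub>difference_ring R\<^esub> diff R i2 \<zero>) \<in>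
        ring_radical (difference_ring R)"
      by (intro D.radical_add D.radical_minus K_rad i)
    then have "diff R i1 i2 \<in> ring_radical (difference_ring R)"
      by (simp add: difference_ring_minus difference_ring_add)
    then obtain u where u: "u \<in> carrier (difference_ring R)" and
      inv: "(\<one>\<^bsub>difference_ring R\<^esub> \<oplus>\<^bsub>difference_ring R\<^esub> diff R i1 i2) \<otimes>\<^bsub>difference_ring R\<^esub> u =
        \<one>\<^bsub>difference_ring R\<^esub>"
      unfolding ring_radical_def using D.one_closed by fastforce
    obtain p q where [simp]: "p \<in> carrier R" "q \<in> carrier R" and "u = diff R p q"
      using u by (rule difference_ring_cases)
    \<comment> \<open>since \<open>u = 1 - (i1 - i2) u\<close>, the element \<open>u - 1\<close> is a difference \<open>c1 - c2\<close> with both terms in \<open>K\<close>\<close>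
    define c1 c2 where c: "c1 = i1 \<otimes> q \<oplus> i2 \<otimes> p" "c2 = i1 \<otimes> p \<oplus> i2 \<otimes> q"
    have cK [simp]: "c1 \<in> K" "c2 \<in> K"
      unfolding c by (auto intro!: K_add K_mult)
    have "u = (\<one>\<^bsub>difference_ring R\<^esub> \<oplus>\<^bsub>difference_ring R\<^esub> diff R i1 i2) \<otimes>\<^bsub>difference_ring R\<^esub> u
        \<ominus>\<^bsub>difference_ring R\<^esub> diff R i1 i2 \<otimes>\<^bsub>difference_ring R\<^esub> u"
      using u by (simp add: D.l_distr D.minus_eq D.a_assoc D.r_neg)
    also have "\<dots> = diff R (\<one> \<oplus> c1) c2"
      unfolding inv unfolding \<open>u = diff R p q\<close>
      by (simp add: c difference_ring_one D.minus_eq difference_ring_mult difference_ring_minus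
          difference_ring_add)
    finally have "diff R (\<one> \<oplus> i1) i2 \<otimes>\<^bsub>difference_ring R\<^esub> diff R (\<one> \<oplus> c1) c2 = \<one>\<^bsub>difference_ring R\<^esub>"
      using inv by (simp add: difference_ring_one difference_ring_add)
    then obtain y where [simp]: "y \<in> carrier R" and
      y: "(\<one> \<oplus> i1) \<otimes> (\<one> \<oplus> c1) \<oplus> i2 \<otimes> c2 \<oplus> y = \<one> \<oplus> ((\<one> \<oplus> i1) \<otimes> c2 \<oplus> i2 \<otimes> (\<one> \<oplus> c1)) \<oplus> y"
      by (auto simp: difference_ring_one difference_ring_mult difference_ring_eq_iff)
    define z where "z = \<one> \<oplus> y"
    define A where "A = i1 \<oplus> c1 \<oplus> i1 \<otimes> c1 \<oplus> i2 \<otimes> c2"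
    define B where "B = i2 \<oplus> c2 \<oplus> i1 \<otimes> c2 \<oplus> i2 \<otimes> c1"
    have AB [simp]: "A \<in> K" "B \<in> K"
      unfolding A_def B_def by (auto intro!: K_add K_mult)
    have [simp]: "z \<in> carrier R"
      by (simp add: z_def)
    have "A \<oplus> z = B \<oplus> z"
      using y by (simp add: A_def B_def z_def l_distr r_distr a_ac)
    then have absorb: "i \<otimes> A \<oplus> i \<otimes> z = i \<otimes> B \<oplus> i \<otimes> z" if "i \<in> carrier R" for i
      using that by (simp add: r_distr[symmetric])
    define e where "e = i1 \<otimes> z \<oplus> i2 \<otimes> z"
    have eK [simp]: "e \<in> K"
      unfolding e_def by (auto intro!: K_add K_mult)
    define j1 j2 where j: "j1 = c1 \<oplus> B \<oplus> e" "j2 = c2 \<oplus> A \<oplus> e"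
    have jK: "j1 \<in> K" "j2 \<in> K"
      unfolding j by (intro K_add cK AB eK)+
    have "i1 \<oplus> j1 \<oplus> i1 \<otimes> j1 \<oplus> i2 \<otimes> j2 =
        A \<oplus> B \<oplus> (i1 \<otimes> B \<oplus> i1 \<otimes> z) \<oplus> (i2 \<otimes> A \<oplus> i2 \<otimes> z) \<oplus> i1 \<otimes> e \<oplus> i2 \<otimes> e"
      by (simp add: j r_distr) (simp add: A_def e_def a_ac)
    also have "\<dots> = A \<oplus> B \<oplus> (i1 \<otimes> A \<oplus> i1 \<otimes> z) \<oplus> (i2 \<otimes> B \<oplus> i2 \<otimes> z) \<oplus> i1 \<otimes> e \<oplus> i2 \<otimes> e"
      by (simp add: absorb)
    also have "\<dots> = i2 \<oplus> j2 \<oplus> i1 \<otimes> j2 \<oplus> i2 \<otimes> j1"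
      by (simp add: j r_distr) (simp add: B_def e_def a_ac)
    finally show ?thesis
      using jK by blast
  qed
  then show ?thesis
    by (simp add: right_semiregular_def K_def[symmetric] del: mem_Collect_eq)
qed

text \<open>
  The preimage of the radical of the ring of differences is the largest right semiregular right
  ideal. This reduces the radical of a semiring to that of a ring.
\<close>

lemma jacobson_radical_eq_preimage:
  "jacobson_radical R = {a \<in> carrier R. diff R a \<zero> \<in> ring_radical (difference_ring R)}"
    (is "_ = ?K")
proof (intro equalityI subsetI)
  fix a assume "a \<in> jacobson_radical R"
  then obtain n :: nat and f where a: "a = (\<Oplus>i\<in>{..<n}. f i)"
    and f: "f \<in> {..<n} \<rightarrow> \<Union>{K. right_ideal R K \<and> right_semiregular R K}"
    by (auto simp: jacobson_radical_def finite_sums_def)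
  have "f i \<in> ?K" if "i < n" for i
  proof -
    from f that obtain K where "right_ideal R K" "right_semiregular R K" "f i \<in> K"
      by (auto simp: Pi_def)
    then show ?thesis
      using right_semiregular_imp_radical[of K "f i"] by (auto simp: right_ideal_def)
  qed
  then show "a \<in> ?K"
    unfolding a
  proof (induction n)
    case 0
    then show ?case
      using right_ideal_radical_preimage by (simp add: right_ideal_def)
  next
    case (Suc n)
    have "(\<Oplus>i\<in>{..<Suc n}. f i) = f n \<oplus> (\<Oplus>i\<in>{..<n}. f i)"
      using Suc.prems by (intro finsum_lessThan_Suc) auto
    moreover have "f n \<in> ?K" "(\<Oplus>i\<in>{..<n}. f i) \<in> ?K"
      using Suc by auto
    moreover have "x \<oplus> y \<in> ?K" if "x \<in> ?K" "y \<in> ?K" for x y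
      using right_ideal_radical_preimage that unfolding right_ideal_def by blast
    ultimately show ?case
      by (simp only:)
  qed
next
  fix a assume a: "a \<in> ?K"
  then have "a = (\<Oplus>i\<in>{..<1::nat}. a)"
    by (simp add: lessThan_Suc)
  moreover have "a \<in> \<Union>{K. right_ideal R K \<and> right_semiregular R K}"
    using a right_ideal_radical_preimage right_semiregular_radical_preimage by blast
  ultimately show "a \<in> jacobson_radical R"
    unfolding jacobson_radical_def finite_sums_def
    by (intro CollectI exI[of _ "1::nat"] exI[of _ "\<lambda>_. a"]) auto
qed

end

section \<open>The equivalence\<close>

context semimodule
begin

interpretation V: semimodule_group R "difference_module M"
  by (rule semimodule_group_difference_module)

interpretation D: ring "difference_ring R"
  by (rule R.ring_difference_ring)

interpretation X: semimodule_group "difference_ring R" "extended_module R (difference_module M)"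
  by (rule V.semimodule_group_extended_module)

text \<open>
  Differences multiply like \<open>(r - s) (a - b) = (r a + s b) - (r b + s a)\<close>. This is where the shape
  of the equation defining a w-finitely generated semimodule comes from.
\<close>

lemma diff_smult_diff:
  assumes "r \<in> carrier R" "s \<in> carrier R" "a \<in> carrier M" "b \<in> carrier M"
  shows "diff R r s \<odot>\<^bsub>extended_module R (difference_module M)\<^esub> diff M a b =
    diff M (r \<odot>\<^bsub>M\<^esub> a \<oplus>\<^bsub>M\<^esub> s \<odot>\<^bsub>M\<^esub> b) (r \<odot>\<^bsub>M\<^esub> b \<oplus>\<^bsub>M\<^esub> s \<odot>\<^bsub>M\<^esub> a)"
  using assms
  by (simp add: V.smult_extended_module diff_smult V.M.minus_eq diff_minus diff_add)

lemma finsum_diff: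
  fixes n :: nat
  assumes "f \<in> {..<n} \<rightarrow> carrier M" "g \<in> {..<n} \<rightarrow> carrier M"
  shows "(\<Oplus>\<^bsub>extended_module R (difference_module M)\<^esub>i\<in>{..<n}. diff M (f i) (g i)) =
    diff M (\<Oplus>\<^bsub>M\<^esub>i\<in>{..<n}. f i) (\<Oplus>\<^bsub>M\<^esub>i\<in>{..<n}. g i)"
  using assms
proof (induction n)
  case 0
  then show ?case by (simp add: diff_zero)
next
  case (Suc n)
  have fg: "f \<in> {..<n} \<rightarrow> carrier M" "g \<in> {..<n} \<rightarrow> carrier M" "f n \<in> carrier M" "g n \<in> carrier M"
    using Suc.prems by auto
  then show ?case
    using Suc.prems Suc.IH[OF fg(1,2)]
    by (simp add: M.finsum_lessThan_Suc X.M.finsum_lessThan_Suc Pi_def diff_add)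
qed

text \<open>
  The equations of w-finite generation say that the differences \<open>h i = g i - g' i\<close> generate the
  difference module of \<open>M\<close> over the ring of differences. Since \<open>I M = M\<close> and \<open>I\<close> maps into the radical,
  each \<open>h i\<close> is a radical combination of the \<open>h j\<close>, so the difference module is zero by Nakayama's
  lemma.
\<close>

lemma jacobson_radical_imp_zeroid:
  assumes I: "I \<subseteq> jacobson_radical R"
    and fg: "w_finitely_generated R M" and IM: "ideal_smult I M = carrier M"
  shows "carrier M = zeroid M"
proof -
  let ?D = "difference_ring R" and ?X = "extended_module R (difference_module M)"
  from fg obtain n :: nat and g g'
    where g: "g \<in> {..<n} \<rightarrow> carrier M" "g' \<in> {..<n} \<rightarrow> carrier M"
    and gen: "\<And>m. m \<in> carrier M \<Longrightarrow> \<exists>r s. r \<in> {..<n} \<rightarrow> carrier R \<and> s \<in> {..<n} \<rightarrow> carrier R \<and>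
           m \<oplus>\<^bsub>M\<^esub> (\<Oplus>\<^bsub>M\<^esub>i\<in>{..<n}. r i \<odot>\<^bsub>M\<^esub> g' i \<oplus>\<^bsub>M\<^esub> s i \<odot>\<^bsub>M\<^esub> g i) =
           (\<Oplus>\<^bsub>M\<^esub>i\<in>{..<n}. r i \<odot>\<^bsub>M\<^esub> g i \<oplus>\<^bsub>M\<^esub> s i \<odot>\<^bsub>M\<^esub> g' i)"
    unfolding w_finitely_generated_def by blast
  define h where "h i = diff M (g i) (g' i)" for i
  have h: "h \<in> {..<n} \<rightarrow> carrier ?X"
    using g by (auto simp: h_def Pi_def)
  have span: "\<exists>d \<in> {..<n} \<rightarrow> carrier ?D. diff M m \<zero>\<^bsub>M\<^esub> = (\<Oplus>\<^bsub>?X\<^esub>i\<in>{..<n}. d i \<odot>\<^bsub>?X\<^esub> h i)"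
    if m: "m \<in> carrier M" for m
  proof -
    from gen[OF m] obtain r s where rs: "r \<in> {..<n} \<rightarrow> carrier R" "s \<in> {..<n} \<rightarrow> carrier R"
      and eq: "m \<oplus>\<^bsub>M\<^esub> (\<Oplus>\<^bsub>M\<^esub>i\<in>{..<n}. r i \<odot>\<^bsub>M\<^esub> g' i \<oplus>\<^bsub>M\<^esub> s i \<odot>\<^bsub>M\<^esub> g i) =
        (\<Oplus>\<^bsub>M\<^esub>i\<in>{..<n}. r i \<odot>\<^bsub>M\<^esub> g i \<oplus>\<^bsub>M\<^esub> s i \<odot>\<^bsub>M\<^esub> g' i)"
      by blast
    have cl: "(\<lambda>i. r i \<odot>\<^bsub>M\<^esub> g i \<oplus>\<^bsub>M\<^esub> s i \<odot>\<^bsub>M\<^esub> g' i) \<in> {..<n} \<rightarrow> carrier M"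
      "(\<lambda>i. r i \<odot>\<^bsub>M\<^esub> g' i \<oplus>\<^bsub>M\<^esub> s i \<odot>\<^bsub>M\<^esub> g i) \<in> {..<n} \<rightarrow> carrier M"
      using rs g by (auto simp: Pi_def)
    have "(\<Oplus>\<^bsub>?X\<^esub>i\<in>{..<n}. diff R (r i) (s i) \<odot>\<^bsub>?X\<^esub> h i) = (\<Oplus>\<^bsub>?X\<^esub>i\<in>{..<n}.
        diff M (r i \<odot>\<^bsub>M\<^esub> g i \<oplus>\<^bsub>M\<^esub> s i \<odot>\<^bsub>M\<^esub> g' i) (r i \<odot>\<^bsub>M\<^esub> g' i \<oplus>\<^bsub>M\<^esub> s i \<odot>\<^bsub>M\<^esub> g i))"
      using rs g by (intro X.M.finsum_cong') (auto simp: h_def diff_smult_diff Pi_def)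
    also have "\<dots> = diff M (\<Oplus>\<^bsub>M\<^esub>i\<in>{..<n}. r i \<odot>\<^bsub>M\<^esub> g i \<oplus>\<^bsub>M\<^esub> s i \<odot>\<^bsub>M\<^esub> g' i)
        (\<Oplus>\<^bsub>M\<^esub>i\<in>{..<n}. r i \<odot>\<^bsub>M\<^esub> g' i \<oplus>\<^bsub>M\<^esub> s i \<odot>\<^bsub>M\<^esub> g i)"
      by (rule finsum_diff[OF cl])
    also have "\<dots> = diff M m \<zero>\<^bsub>M\<^esub>"
      unfolding eq[symmetric] using m cl
      by (subst diff_eq_iff) (auto intro!: bexI[of _ "\<zero>\<^bsub>M\<^esub>"])
    finally show ?thesis
      using rs by (intro bexI[of _ "\<lambda>i. diff R (r i) (s i)"]) (auto simp: Pi_def)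
  qed
  define comb where
    "comb v \<longleftrightarrow> (\<exists>b \<in> {..<n} \<rightarrow> ring_radical ?D. v = (\<Oplus>\<^bsub>?X\<^esub>i\<in>{..<n}. b i \<odot>\<^bsub>?X\<^esub> h i))" for v
  have comb_add: "comb (v \<oplus>\<^bsub>?X\<^esub> w)" if vw: "comb v" "comb w" for v w
  proof -
    from vw obtain b c where bc: "b \<in> {..<n} \<rightarrow> ring_radical ?D" "c \<in> {..<n} \<rightarrow> ring_radical ?D"
      and eq: "v = (\<Oplus>\<^bsub>?X\<^esub>i\<in>{..<n}. b i \<odot>\<^bsub>?X\<^esub> h i)" "w = (\<Oplus>\<^bsub>?X\<^esub>i\<in>{..<n}. c i \<odot>\<^bsub>?X\<^esub> h i)"
      by (auto simp: comb_def)
    have "b \<in> {..<n} \<rightarrow> carrier ?D" "c \<in> {..<n} \<rightarrow> carrier ?D"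
      using bc D.radical_subset by (auto simp: Pi_def)
    then have "v \<oplus>\<^bsub>?X\<^esub> w = (\<Oplus>\<^bsub>?X\<^esub>i\<in>{..<n}. (b i \<oplus>\<^bsub>?D\<^esub> c i) \<odot>\<^bsub>?X\<^esub> h i)"
      unfolding eq by (rule X.finsum_smult_add[OF _ _ h])
    with bc show ?thesis
      unfolding comb_def
      by (intro bexI[of _ "\<lambda>i. b i \<oplus>\<^bsub>?D\<^esub> c i"]) (auto intro!: D.radical_add simp: Pi_def)
  qed
  have comb_smult: "comb (d \<odot>\<^bsub>?X\<^esub> v)" if v: "comb v" and d: "d \<in> carrier ?D" for d v
  proof -
    from v obtain b where b: "b \<in> {..<n} \<rightarrow> ring_radical ?D"
      and eq: "v = (\<Oplus>\<^bsub>?X\<^esub>i\<in>{..<n}. b i \<odot>\<^bsub>?X\<^esub> h i)"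
      by (auto simp: comb_def)
    have "b \<in> {..<n} \<rightarrow> carrier ?D"
      using b D.radical_subset by (auto simp: Pi_def)
    then have "d \<odot>\<^bsub>?X\<^esub> v = (\<Oplus>\<^bsub>?X\<^esub>i\<in>{..<n}. (d \<otimes>\<^bsub>?D\<^esub> b i) \<odot>\<^bsub>?X\<^esub> h i)"
      unfolding eq by (rule X.smult_finsum_smult[OF d _ h])
    with b d show ?thesis
      unfolding comb_def
      by (intro bexI[of _ "\<lambda>i. d \<otimes>\<^bsub>?D\<^esub> b i"]) (auto intro!: D.radical_mult_left simp: Pi_def)
  qed
  have comb_radical: "comb (diff M (a \<odot>\<^bsub>M\<^esub> m) \<zero>\<^bsub>M\<^esub>)" if a: "a \<in> I" and m: "m \<in> carrier M" for a m
  proof -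
    have [simp]: "a \<in> carrier R" and a_rad: "diff R a \<zero>\<^bsub>R\<^esub> \<in> ring_radical ?D"
      using a I by (auto simp: R.jacobson_radical_eq_preimage)
    from span[OF m] obtain d where d: "d \<in> {..<n} \<rightarrow> carrier ?D"
      and eq: "diff M m \<zero>\<^bsub>M\<^esub> = (\<Oplus>\<^bsub>?X\<^esub>i\<in>{..<n}. d i \<odot>\<^bsub>?X\<^esub> h i)"
      by blast
    have "diff M (a \<odot>\<^bsub>M\<^esub> m) \<zero>\<^bsub>M\<^esub> = diff R a \<zero>\<^bsub>R\<^esub> \<odot>\<^bsub>?X\<^esub> diff M m \<zero>\<^bsub>M\<^esub>"
      using m by (simp add: diff_smult_diff)
    also have "\<dots> = (\<Oplus>\<^bsub>?X\<^esub>i\<in>{..<n}. (diff R a \<zero>\<^bsub>R\<^esub> \<otimes>\<^bsub>?D\<^esub> d i) \<odot>\<^bsub>?X\<^esub> h i)"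
      unfolding eq by (rule X.smult_finsum_smult[OF _ d h]) simp
    finally show ?thesis
      unfolding comb_def using d a_rad
      by (intro bexI[of _ "\<lambda>i. diff R a \<zero>\<^bsub>R\<^esub> \<otimes>\<^bsub>?D\<^esub> d i"])
        (auto intro!: D.radical_mult_right simp: Pi_def)
  qed
  have comb_zero: "comb \<zero>\<^bsub>?X\<^esub>"
  proof -
    have "(\<Oplus>\<^bsub>?X\<^esub>i\<in>{..<n}. \<zero>\<^bsub>?D\<^esub> \<odot>\<^bsub>?X\<^esub> h i) = (\<Oplus>\<^bsub>?X\<^esub>i\<in>{..<n}. \<zero>\<^bsub>?X\<^esub>)"
      using h by (intro X.M.finsum_cong') (auto simp: Pi_def)
    also have "\<dots> = \<zero>\<^bsub>?X\<^esub>"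
      by (rule X.M.finsum_zero)
    finally show ?thesis
      unfolding comb_def by (intro bexI[of _ "\<lambda>_. \<zero>\<^bsub>?D\<^esub>"] funcsetI D.zero_in_radical) (rule sym)
  qed
  have comb_all: "comb (diff M m \<zero>\<^bsub>M\<^esub>)" if "m \<in> carrier M" for m
  proof -
    from that[folded IM] obtain k :: nat and f where m: "m = (\<Oplus>\<^bsub>M\<^esub>i\<in>{..<k}. f i)"
      and f: "f \<in> {..<k} \<rightarrow> {a \<odot>\<^bsub>M\<^esub> m | a m. a \<in> I \<and> m \<in> carrier M}"
      by (auto simp: ideal_smult_def finite_sums_def)
    have IR: "a \<in> carrier R" if "a \<in> I" for a
      using that I by (auto simp: R.jacobson_radical_eq_preimage)
    from f show ?thesis
      unfolding m
    proof (induction k)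
      case 0
      then show ?case
        using comb_zero by (simp add: diff_zero)
    next
      case (Suc k)
      have fM: "f \<in> {..<Suc k} \<rightarrow> carrier M"
        using Suc.prems IR by (fastforce simp: Pi_def)
      from Suc.prems obtain a m where am: "a \<in> I" "m \<in> carrier M" "f k = a \<odot>\<^bsub>M\<^esub> m"
        by (force simp: Pi_def)
      have "diff M (\<Oplus>\<^bsub>M\<^esub>i\<in>{..<Suc k}. f i) \<zero>\<^bsub>M\<^esub> =
          diff M (a \<odot>\<^bsub>M\<^esub> m) \<zero>\<^bsub>M\<^esub> \<oplus>\<^bsub>?X\<^esub> diff M (\<Oplus>\<^bsub>M\<^esub>i\<in>{..<k}. f i) \<zero>\<^bsub>M\<^esub>"
        using fM am IR by (simp add: M.finsum_lessThan_Suc diff_add Pi_def)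
      moreover have "comb (diff M (\<Oplus>\<^bsub>M\<^esub>i\<in>{..<k}. f i) \<zero>\<^bsub>M\<^esub>)"
        using Suc.prems by (intro Suc.IH) (auto simp: Pi_def)
      ultimately show ?case
        using comb_add comb_radical am by simp
    qed
  qed
  have h_comb: "comb (h i)" if "i < n" for i
  proof -
    have gi [simp]: "g i \<in> carrier M" "g' i \<in> carrier M"
      using g that by (auto simp: Pi_def)
    \<comment> \<open>the difference \<open>0 - 1\<close> acts as negation, so closure under the action covers subtraction\<close>
    have "h i = diff M (g i) \<zero>\<^bsub>M\<^esub> \<oplus>\<^bsub>?X\<^esub> diff R \<zero>\<^bsub>R\<^esub> \<one>\<^bsub>R\<^esub> \<odot>\<^bsub>?X\<^esub> diff M (g' i) \<zero>\<^bsub>M\<^esub>"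
      by (subst diff_smult_diff) (simp_all add: h_def diff_add)
    then show ?thesis
      using comb_all[OF gi(1)] comb_smult[OF comb_all[OF gi(2)], of "diff R \<zero>\<^bsub>R\<^esub> \<one>\<^bsub>R\<^esub>"] comb_add
      by simp
  qed
  have h_zero: "h i = \<zero>\<^bsub>?X\<^esub>" if "i < n" for i
    using nakayama[OF D.ring_axioms X.semimodule_group_axioms h _ that] h_comb
    unfolding comb_def by blast
  have "m \<in> zeroid M" if m: "m \<in> carrier M" for m
  proof -
    from span[OF m] obtain d where d: "d \<in> {..<n} \<rightarrow> carrier ?D"
      and eq: "diff M m \<zero>\<^bsub>M\<^esub> = (\<Oplus>\<^bsub>?X\<^esub>i\<in>{..<n}. d i \<odot>\<^bsub>?X\<^esub> h i)"
      by blast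
    note eq
    also have "(\<Oplus>\<^bsub>?X\<^esub>i\<in>{..<n}. d i \<odot>\<^bsub>?X\<^esub> h i) = (\<Oplus>\<^bsub>?X\<^esub>i\<in>{..<n}. \<zero>\<^bsub>?X\<^esub>)"
      using d by (intro X.M.finsum_cong')
        (auto simp: h_zero X.smult_r_null[simplified] Pi_def)
    also have "\<dots> = \<zero>\<^bsub>?X\<^esub>"
      by (rule X.M.finsum_zero)
    finally have "diff M m \<zero>\<^bsub>M\<^esub> = diff M \<zero>\<^bsub>M\<^esub> \<zero>\<^bsub>M\<^esub>"
      by (simp add: diff_zero)
    then show ?thesis
      using m by (subst (asm) diff_eq_iff) (auto simp: zeroid_def)
  qed
  then show ?thesis
    by (auto simp: zeroid_def)
qed

end

context semiring
begin

interpretation D: ring "difference_ring R"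
  by (rule ring_difference_ring)

interpretation reg: semimodule R "regular_module R"
  by (rule semimodule_regular)

text \<open>
  Congruence modulo the left ideal \<open>D t\<close> of the ring of differences \<open>D\<close>, pulled back to pairs over
  \<open>R\<close>. The quotient is a copy of \<open>D / D t\<close> whose elements are sets of pairs over \<open>R\<close>, rather than
  sets of classes of such pairs.
\<close>

definition left_multiple_congruence :: "('a \<times> 'a) set \<Rightarrow> (('a \<times> 'a) \<times> 'a \<times> 'a) set" where
  "left_multiple_congruence t =
     {((a, b), (c, d)). a \<in> carrier R \<and> b \<in> carrier R \<and> c \<in> carrier R \<and> d \<in> carrier R \<and>
        (\<exists>y\<in>carrier (difference_ring R).
           diff R a b = diff R c d \<oplus>\<^bsub>difference_ring R\<^esub> y \<otimes>\<^bsub>difference_ring R\<^esub> t)}"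

lemma congruence_left_multiple_congruence:
  assumes [simp]: "t \<in> carrier (difference_ring R)"
  shows "semimodule_congruence R (pair_semimodule (regular_module R)) (left_multiple_congruence t)"
proof (intro semimodule_congruence.intro reg.semimodule_pair semimodule_congruence_axioms.intro)
  let ?E = "left_multiple_congruence t" and ?D = "difference_ring R"
  have car: "carrier (pair_semimodule (regular_module R)) = carrier R \<times> carrier R"
    by (simp add: pair_semimodule_def)
  show "equiv (carrier (pair_semimodule (regular_module R))) ?E"
    unfolding car
  proof (rule equivI)
    show "?E \<subseteq> (carrier R \<times> carrier R) \<times> carrier R \<times> carrier R"
      by (auto simp: left_multiple_congruence_def)
    show "refl_on (carrier R \<times> carrier R) ?E"
      by (auto simp: left_multiple_congruence_def refl_on_def intro!: bexI[of _ "\<zero>\<^bsub>?D\<^esub>"])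
    show "sym ?E"
    proof (rule symI)
      fix p q assume "(p, q) \<in> ?E"
      then obtain a b c d y where p: "p = (a, b)" "q = (c, d)"
        and [simp]: "a \<in> carrier R" "b \<in> carrier R" "c \<in> carrier R" "d \<in> carrier R"
          "y \<in> carrier ?D"
        and eq: "diff R a b = diff R c d \<oplus>\<^bsub>?D\<^esub> y \<otimes>\<^bsub>?D\<^esub> t"
        by (auto simp: left_multiple_congruence_def)
      have "diff R c d = diff R a b \<oplus>\<^bsub>?D\<^esub> (\<ominus>\<^bsub>?D\<^esub> y) \<otimes>\<^bsub>?D\<^esub> t"
        unfolding eq by (simp add: D.l_minus D.a_assoc D.r_neg)
      then show "(q, p) \<in> ?E"
        unfolding left_multiple_congruence_def p by (auto intro: D.a_inv_closed)
    qed
    show "trans ?E"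
    proof (rule transI)
      fix p q r assume "(p, q) \<in> ?E" "(q, r) \<in> ?E"
      then obtain a b c d e f y z where p: "p = (a, b)" "q = (c, d)" "r = (e, f)"
        and [simp]: "a \<in> carrier R" "b \<in> carrier R" "c \<in> carrier R" "d \<in> carrier R"
          "e \<in> carrier R" "f \<in> carrier R" "y \<in> carrier ?D" "z \<in> carrier ?D"
        and eq: "diff R a b = diff R c d \<oplus>\<^bsub>?D\<^esub> y \<otimes>\<^bsub>?D\<^esub> t" "diff R c d = diff R e f \<oplus>\<^bsub>?D\<^esub> z \<otimes>\<^bsub>?D\<^esub> t"
        by (auto simp: left_multiple_congruence_def)
      have "diff R a b = diff R e f \<oplus>\<^bsub>?D\<^esub> (z \<oplus>\<^bsub>?D\<^esub> y) \<otimes>\<^bsub>?D\<^esub> t"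
        unfolding eq by (simp add: D.l_distr D.a_assoc)
      then show "(p, r) \<in> ?E"
        unfolding left_multiple_congruence_def p by (auto intro: D.a_closed)
    qed
  qed
next
  let ?E = "left_multiple_congruence t" and ?D = "difference_ring R"
  fix p p' q q' assume "(p, p') \<in> ?E" "(q, q') \<in> ?E"
  then obtain a b c d a' b' c' d' y y' where
    p: "p = (a, b)" "p' = (c, d)" "q = (a', b')" "q' = (c', d')"
    and [simp]: "a \<in> carrier R" "b \<in> carrier R" "c \<in> carrier R" "d \<in> carrier R"
      "a' \<in> carrier R" "b' \<in> carrier R" "c' \<in> carrier R" "d' \<in> carrier R"
      "y \<in> carrier ?D" "y' \<in> carrier ?D"
    and eq: "diff R a b = diff R c d \<oplus>\<^bsub>?D\<^esub> y \<otimes>\<^bsub>?D\<^esub> t" "diff R a' b' = diff R c' d' \<oplus>\<^bsub>?D\<^esub> y' \<otimes>\<^bsub>?D\<^esub> t"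
    by (auto simp: left_multiple_congruence_def)
  have "diff R (a \<oplus> a') (b \<oplus> b') = diff R (c \<oplus> c') (d \<oplus> d') \<oplus>\<^bsub>?D\<^esub> (y \<oplus>\<^bsub>?D\<^esub> y') \<otimes>\<^bsub>?D\<^esub> t"
    by (simp add: difference_ring_add[symmetric] eq D.l_distr D.a_ac)
  then show "(p \<oplus>\<^bsub>pair_semimodule (regular_module R)\<^esub> q,
      p' \<oplus>\<^bsub>pair_semimodule (regular_module R)\<^esub> q') \<in> ?E"
    unfolding left_multiple_congruence_def p
    by (auto simp: pair_semimodule_def intro: D.a_closed)
next
  let ?E = "left_multiple_congruence t" and ?D = "difference_ring R"
  fix r p p' assume [simp]: "r \<in> carrier R" and "(p, p') \<in> ?E"
  then obtain a b c d y where p: "p = (a, b)" "p' = (c, d)"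
    and [simp]: "a \<in> carrier R" "b \<in> carrier R" "c \<in> carrier R" "d \<in> carrier R" "y \<in> carrier ?D"
    and eq: "diff R a b = diff R c d \<oplus>\<^bsub>?D\<^esub> y \<otimes>\<^bsub>?D\<^esub> t"
    by (auto simp: left_multiple_congruence_def)
  have scale: "diff R (r \<otimes> a) (r \<otimes> b) = diff R r \<zero> \<otimes>\<^bsub>?D\<^esub> diff R a b"
    if "a \<in> carrier R" "b \<in> carrier R" for a b
    using that by (simp add: difference_ring_mult)
  have "diff R (r \<otimes> a) (r \<otimes> b) =
      diff R (r \<otimes> c) (r \<otimes> d) \<oplus>\<^bsub>?D\<^esub> (diff R r \<zero> \<otimes>\<^bsub>?D\<^esub> y) \<otimes>\<^bsub>?D\<^esub> t"
    by (simp add: scale eq D.r_distr D.m_assoc)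
  then show "(r \<odot>\<^bsub>pair_semimodule (regular_module R)\<^esub> p,
      r \<odot>\<^bsub>pair_semimodule (regular_module R)\<^esub> p') \<in> ?E"
    unfolding left_multiple_congruence_def p
    by (auto simp: pair_semimodule_def intro: D.m_closed)
qed

text \<open>
  Choose \<open>x\<close> in the ring of differences \<open>D\<close> such that \<open>t = 1 + x a\<close> has no left inverse, and let \<open>M\<close>
  be \<open>D / D t\<close>. It is cyclic and nonzero, and being a group it has zeroid \<open>{0}\<close>. In \<open>M\<close> the generator
  \<open>1\<close> equals \<open>- x a\<close>, so every element \<open>d\<close> equals \<open>- d x a\<close> and lies in \<open>I M\<close>.
\<close>

lemma cyclic_module_of_nonradical:
  assumes I: "left_ideal R I" and a: "a \<in> I" "a \<notin> jacobson_radical R"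
  obtains M :: "('a, ('a \<times> 'a) set) module"
  where "semimodule R M" "w_finitely_generated R M" "ideal_smult I M = carrier M"
    "carrier M \<noteq> zeroid M"
proof -
  let ?D = "difference_ring R"
  have [simp]: "a \<in> carrier R"
    using I a(1) by (auto simp: left_ideal_def)
  have "diff R a \<zero> \<notin> ring_radical ?D"
    using a(2) by (simp add: jacobson_radical_eq_preimage)
  then obtain x where x [simp]: "x \<in> carrier ?D"
    and no_inv: "\<And>u. u \<in> carrier ?D \<Longrightarrow> u \<otimes>\<^bsub>?D\<^esub> (\<one>\<^bsub>?D\<^esub> \<oplus>\<^bsub>?D\<^esub> x \<otimes>\<^bsub>?D\<^esub> diff R a \<zero>) \<noteq> \<one>\<^bsub>?D\<^esub>"
    by (auto simp: D.mem_radical_iff_left_invertible)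
  define t where "t = \<one>\<^bsub>?D\<^esub> \<oplus>\<^bsub>?D\<^esub> x \<otimes>\<^bsub>?D\<^esub> diff R a \<zero>"
  have t [simp]: "t \<in> carrier ?D"
    by (simp add: t_def)
  define E where "E = left_multiple_congruence t"
  interpret E: semimodule_congruence R "pair_semimodule (regular_module R)" E
    unfolding E_def by (rule congruence_left_multiple_congruence) simp
  \<comment> \<open>\<open>c p q\<close> is the residue class of \<open>p - q\<close>\<close>
  define c where "c p q = E `` {(p, q)}" for p q
  let ?M = "quot_semimodule (pair_semimodule (regular_module R)) E"
  interpret M: semimodule R ?M
    by (rule E.semimodule_quot)
  have c_closed [simp, intro]: "c p q \<in> carrier ?M" if "p \<in> carrier R" "q \<in> carrier R" for p q
    using that E.quot_carrierI[of "(p, q)"] by (simp add: c_def pair_semimodule_def)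
  have c_cases: "\<exists>p q. p \<in> carrier R \<and> q \<in> carrier R \<and> v = c p q" if v: "v \<in> carrier ?M" for v
  proof -
    from v obtain pq where "pq \<in> carrier (pair_semimodule (regular_module R))" "v = E `` {pq}"
      by (rule E.quot_carrierE)
    then show ?thesis
      by (auto simp: c_def pair_semimodule_def)
  qed
  have c_eq: "c p q = c p' q' \<longleftrightarrow> 
      (\<exists>y\<in>carrier ?D. diff R p q = diff R p' q' \<oplus>\<^bsub>?D\<^esub> y \<otimes>\<^bsub>?D\<^esub> t)"
    if "p \<in> carrier R" "q \<in> carrier R" "p' \<in> carrier R" "q' \<in> carrier R" for p q p' q'
    using that E.quot_eq_iff[of "(p, q)" "(p', q')"]
    by (simp add: c_def pair_semimodule_def E_def left_multiple_congruence_def)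
  have c_add: "c p q \<oplus>\<^bsub>?M\<^esub> c p' q' = c (p \<oplus> p') (q \<oplus> q')"
    if "p \<in> carrier R" "q \<in> carrier R" "p' \<in> carrier R" "q' \<in> carrier R" for p q p' q'
    using that E.quot_add[of "(p, q)" "(p', q')"]
    by (simp add: c_def pair_semimodule_def)
  have c_smult: "r \<odot>\<^bsub>?M\<^esub> c p q = c (r \<otimes> p) (r \<otimes> q)"
    if "r \<in> carrier R" "p \<in> carrier R" "q \<in> carrier R" for r p q
    using that E.quot_smult[of r "(p, q)"]
    by (simp add: c_def pair_semimodule_def)
  have c_eqI: "c p q = c p' q'" if "p \<in> carrier R" "q \<in> carrier R" "p' \<in> carrier R" "q' \<in> carrier R"
    "diff R p q = diff R p' q'" for p q p' q'
    using that by (auto simp: c_eq intro!: bexI[of _ "\<zero>\<^bsub>?D\<^esub>"])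
  have "w_finitely_generated R ?M"
    unfolding w_finitely_generated_def
  \<comment> \<open>one pair of generators, \<open>1\<close> and \<open>0\<close>, suffices: \<open>p - q\<close> is \<open>p 1 - q 1\<close>\<close>
  proof (rule exI[of _ 1], rule exI[of _ "\<lambda>_. c \<one> \<zero>"], rule exI[of _ "\<lambda>_. c \<zero> \<zero>"], intro conjI ballI)
    fix m assume "m \<in> carrier ?M"
    with c_cases obtain p q where pq [simp]: "p \<in> carrier R" "q \<in> carrier R" "m = c p q"
      by blast
    have "c (p \<oplus> q) q = c p \<zero>"
      by (rule c_eqI) (auto simp: difference_ring_eq_iff a_ac)
    then have "m \<oplus>\<^bsub>?M\<^esub> (\<Oplus>\<^bsub>?M\<^esub>i\<in>{..<1::nat}. p \<odot>\<^bsub>?M\<^esub> c \<zero> \<zero> \<oplus>\<^bsub>?M\<^esub> q \<odot>\<^bsub>?M\<^esub> c \<one> \<zero>) =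
        (\<Oplus>\<^bsub>?M\<^esub>i\<in>{..<1::nat}. p \<odot>\<^bsub>?M\<^esub> c \<one> \<zero> \<oplus>\<^bsub>?M\<^esub> q \<odot>\<^bsub>?M\<^esub> c \<zero> \<zero>)"
      by (simp add: lessThan_Suc c_smult c_add)
    then show "\<exists>r s. r \<in> {..<1::nat} \<rightarrow> carrier R \<and> s \<in> {..<1} \<rightarrow> carrier R \<and>
        m \<oplus>\<^bsub>?M\<^esub> (\<Oplus>\<^bsub>?M\<^esub>i\<in>{..<1}. r i \<odot>\<^bsub>?M\<^esub> c \<zero> \<zero> \<oplus>\<^bsub>?M\<^esub> s i \<odot>\<^bsub>?M\<^esub> c \<one> \<zero>) =
        (\<Oplus>\<^bsub>?M\<^esub>i\<in>{..<1}. r i \<odot>\<^bsub>?M\<^esub> c \<one> \<zero> \<oplus>\<^bsub>?M\<^esub> s i \<odot>\<^bsub>?M\<^esub> c \<zero> \<zero>)"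
      by (intro exI[of _ "\<lambda>_. p"] exI[of _ "\<lambda>_. q"]) auto
  qed auto
  moreover have "ideal_smult I ?M = carrier ?M"
  proof (intro equalityI subsetI)
    fix v assume "v \<in> ideal_smult I ?M"
    then show "v \<in> carrier ?M"
      using I by (force simp: ideal_smult_def finite_sums_def left_ideal_def Pi_def
          intro!: M.M.finsum_closed)
  next
    fix v assume "v \<in> carrier ?M"
    with c_cases obtain p q where pq [simp]: "p \<in> carrier R" "q \<in> carrier R" and v: "v = c p q"
      by blast
    have "diff R p q \<otimes>\<^bsub>?D\<^esub> x \<in> carrier ?D"
      by simp
    then obtain r s where rs [simp]: "r \<in> carrier R" "s \<in> carrier R"
      and px: "diff R p q \<otimes>\<^bsub>?D\<^esub> x = diff R r s"
      by (rule difference_ring_cases)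
    \<comment> \<open>\<open>d = - (r - s) a + d t\<close> for \<open>d = p - q\<close> and \<open>d x = r - s\<close>\<close>
    have *: "diff R p q = diff R (s \<otimes> a) (r \<otimes> a) \<oplus>\<^bsub>?D\<^esub> diff R p q \<otimes>\<^bsub>?D\<^esub> t"
    proof -
      have "diff R p q \<otimes>\<^bsub>?D\<^esub> t = diff R p q \<oplus>\<^bsub>?D\<^esub> (diff R p q \<otimes>\<^bsub>?D\<^esub> x) \<otimes>\<^bsub>?D\<^esub> diff R a \<zero>"
        by (simp add: t_def D.r_distr D.m_assoc)
      also have "\<dots> = diff R p q \<oplus>\<^bsub>?D\<^esub> diff R (r \<otimes> a) (s \<otimes> a)"
        by (simp add: px difference_ring_mult)
      finally show ?thesis
        by (simp add: difference_ring_add difference_ring_eq_iff) (auto simp: a_ac)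
    qed
    define f where "f i =
      (if i = 0 then (s \<otimes> a) \<odot>\<^bsub>?M\<^esub> c \<one> \<zero> else (r \<otimes> a) \<odot>\<^bsub>?M\<^esub> c \<zero> \<one>)" for i :: nat
    have "v = c (s \<otimes> a) (r \<otimes> a)"
      unfolding v using * by (auto simp: c_eq intro: bexI[of _ "diff R p q"])
    \<comment> \<open>\<open>M\<close> contains \<open>-1\<close>, so coefficients from \<open>I\<close> suffice to write the difference \<open>s a - r a\<close>\<close>
    also have "\<dots> = (r \<otimes> a) \<odot>\<^bsub>?M\<^esub> c \<zero> \<one> \<oplus>\<^bsub>?M\<^esub> (s \<otimes> a) \<odot>\<^bsub>?M\<^esub> c \<one> \<zero>"
      by (simp add: c_smult c_add)
    also have "\<dots> = (\<Oplus>\<^bsub>?M\<^esub>i\<in>{..<2::nat}.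
        if i = 0 then (s \<otimes> a) \<odot>\<^bsub>?M\<^esub> c \<one> \<zero> else (r \<otimes> a) \<odot>\<^bsub>?M\<^esub> c \<zero> \<one>)"
      by (simp add: numeral_2_eq_2 lessThan_Suc)
    finally have "v = (\<Oplus>\<^bsub>?M\<^esub>i\<in>{..<2::nat}. f i)"
      by (simp only: f_def)
    moreover have "s \<otimes> a \<in> I" "r \<otimes> a \<in> I"
      using I a(1) rs by (auto simp: left_ideal_def)
    then have "f \<in> {..<2} \<rightarrow> {b \<odot>\<^bsub>?M\<^esub> m | b m. b \<in> I \<and> m \<in> carrier ?M}"
      unfolding f_def using c_closed[OF one_closed zero_closed] c_closed[OF zero_closed one_closed]
      by (intro funcsetI) (simp only: mem_Collect_eq split: if_split, blast)
    ultimately show "v \<in> ideal_smult I ?M"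
      unfolding ideal_smult_def finite_sums_def by blast
  qed
  moreover have "carrier ?M \<noteq> zeroid ?M"
  proof
    assume "carrier ?M = zeroid ?M"
    then have "c \<one> \<zero> \<in> zeroid ?M"
      by auto
    then obtain v where "v \<in> carrier ?M" and v: "c \<one> \<zero> \<oplus>\<^bsub>?M\<^esub> v = v"
      by (auto simp: zeroid_def)
    with c_cases obtain p q where pq [simp]: "p \<in> carrier R" "q \<in> carrier R" "v = c p q"
      by blast
    from v have "c (\<one> \<oplus> p) q = c p q"
      by (simp add: c_add)
    then obtain y where [simp]: "y \<in> carrier ?D"
      and y: "diff R (\<one> \<oplus> p) q = diff R p q \<oplus>\<^bsub>?D\<^esub> y \<otimes>\<^bsub>?D\<^esub> t"
      by (auto simp: c_eq)
    have "diff R (\<one> \<oplus> p) q = diff R p q \<oplus>\<^bsub>?D\<^esub> \<one>\<^bsub>?D\<^esub>"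
      by (simp add: difference_ring_one difference_ring_add a_comm)
    with y have "\<ominus>\<^bsub>?D\<^esub> diff R p q \<oplus>\<^bsub>?D\<^esub> (diff R p q \<oplus>\<^bsub>?D\<^esub> \<one>\<^bsub>?D\<^esub>) =
        \<ominus>\<^bsub>?D\<^esub> diff R p q \<oplus>\<^bsub>?D\<^esub> (diff R p q \<oplus>\<^bsub>?D\<^esub> y \<otimes>\<^bsub>?D\<^esub> t)"
      by (simp only:)
    then have "y \<otimes>\<^bsub>?D\<^esub> t = \<one>\<^bsub>?D\<^esub>"
      by (simp add: D.r_neg1)
    with no_inv show False
      by (simp add: t_def)
  qed
  ultimately show ?thesis
    using that M.semimodule_axioms by blast
qed

end

(* A formula cannot quantify over all types of semimodule elements.  The equivalence is stated
   for semimodules on subsets of ('r * 'r) set, where every quotient of the ring of differences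
   of R lives; the second conjunct extends (i) ==> (ii) to semimodules of any element type 'm.
   Together they give the equivalence with (ii) read over all semimodules. *)
theorem theorem4p3:
  fixes R :: "('r, 'x) ring_scheme" and I :: "'r set"
  assumes "semiring R"
    and "\<one>\<^bsub>R\<^esub> \<notin> zeroid R"
    and "left_ideal R I"
  shows
    "(I \<subseteq> jacobson_radical R \<longleftrightarrow>
       (\<forall>M :: ('r, ('r \<times> 'r) set) module.
          semimodule R M \<and> w_finitely_generated R M \<and> ideal_smult I M = carrier M
            \<longrightarrow> carrier M = zeroid M))
     \<and>
     (I \<subseteq> jacobson_radical R \<longrightarrow>
       (\<forall>M :: ('r, 'm) module.
          semimodule R M \<and> w_finitely_generated R M \<and> ideal_smult I M = carrier M
            \<longrightarrow> carrier M = zeroid M))"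
proof (intro conjI iffI impI allI; (elim conjE)?)
  assume ii: "\<forall>M :: ('r, ('r \<times> 'r) set) module.
    semimodule R M \<and> w_finitely_generated R M \<and> ideal_smult I M = carrier M
      \<longrightarrow> carrier M = zeroid M"
  show "I \<subseteq> jacobson_radical R"
  proof (rule subsetI, rule ccontr)
    fix a assume "a \<in> I" "a \<notin> jacobson_radical R"
    then obtain M :: "('r, ('r \<times> 'r) set) module" where "semimodule R M"
      "w_finitely_generated R M" "ideal_smult I M = carrier M" "carrier M \<noteq> zeroid M"
      by (rule semiring.cyclic_module_of_nonradical[OF assms(1,3)])
    with ii show False by blast
  qed
qed (rule semimodule.jacobson_radical_imp_zeroid; assumption)+

end
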